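(* In the setting described in the context, there is a fixed-point free involution on \[ \mathcal{R}_{\{a\},\{b,c,d,e,f\}} \cup \mathcal{R}_{\{b\},\{a,c,d,e,f\}} \cup \mathcal{R}_{\{c\},\{a,b,d,e,f\}} \cup \mathcal{R}_{\{d\},\{a,b,c,e,f\}} \cup \mathcal{R}_{\{e\},\{a,b,c,d,f\}} \cup \mathcal{R}_{\{f\},\{a,b,c,d,e\}}, \] and thus \[ r_{\{a\},\{b,c,d,e,f\}} + r_{\{b\},\{a,c,d,e,f\}} + r_{\{c\},\{a,b,d,e,f\}} + r_{\{d\},\{a,b,c,e,f\}} + r_{\{e\},\{a,b,c,d,f\}} + r_{\{f\},\{a,b,c,d,e\}} \equiv 0 \pmod 2. \]
   Context: Let $G$ be a connected 4-regular graph and let $v,w$ be adjacent vertices of $G$ with no common neighbours. Label the vertices so that $w$ is adjacent to $v,a,b,c$ and $v$ is adjacent to $w,d,e,f$, where $a,b,c,d,e,f$ are six distinct vertices. Let $R=G-\{v,w\}$ be the graph obtained by deleting $v,w$ and their incident edges. A spanning 2-forest of a graph is a spanning forest with exactly two connected components (trees). For a bipartition $P=P_1\cup P_2$ of $\{a,b,c,d,e,f\}$, a spanning 2-forest $\phi=T_1\cup T_2$ is compatible with $P$ if $T_i$ contains all vertices of $P_i$ and no vertex of the other part, for $i=1,2$. Let $\mathcal{R}_P$ be the set of ordered pairs $(\psi,\phi)$ of edge sets that partition $E(R)$ such that $\psi$ is a spanning tree of $R$ and $\phi$ is a spanning 2-forest of $R$ compatible with $P$, and let $r_P=|\mathcal{R}_P|$.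 *)

theory Defs
  imports "HOL-Number_Theory.Cong"
begin

text \<open>
  Undirected multigraphs: edges have an identity of their own, and an edge with a one-element set of
  ends is a loop. Simple graphs are the case where \<open>ends\<close> is injective on the edges and there are
  no loops.
\<close>

record ('v, 'e) mgraph =
  verts :: "'v set"
  edges :: "'e set"
  ends :: "'e \<Rightarrow> 'v set"

definition finite_mgraph :: "('v, 'e) mgraph \<Rightarrow> bool" where
  "finite_mgraph G \<longleftrightarrow> finite (verts G) \<and> finite (edges G) \<and>
     (\<forall>e\<in>edges G. ends G e \<subseteq> verts G \<and> card (ends G e) \<in> {1, 2})"

text \<open>A loop at \<open>v\<close> contributes two to the degree of \<open>v\<close>.\<close>

definition degree :: "('v, 'e) mgraph \<Rightarrow> 'v \<Rightarrow> nat" where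
  "degree G v = card {e \<in> edges G. v \<in> ends G e} + card {e \<in> edges G. ends G e = {v}}"

definition regular :: "nat \<Rightarrow> ('v, 'e) mgraph \<Rightarrow> bool" where
  "regular k G \<longleftrightarrow> (\<forall>v\<in>verts G. degree G v = k)"

definition adj_rel :: "('v, 'e) mgraph \<Rightarrow> ('v \<times> 'v) set" where
  "adj_rel G = {(x, y). \<exists>e\<in>edges G. ends G e = {x, y}}"

definition neighbours :: "('v, 'e) mgraph \<Rightarrow> 'v \<Rightarrow> 'v set" where
  "neighbours G x = {y. (x, y) \<in> adj_rel G}"

definition component_of :: "('v, 'e) mgraph \<Rightarrow> 'v \<Rightarrow> 'v set" where
  "component_of G x = {y \<in> verts G. (x, y) \<in> (adj_rel G)\<^sup>*}"

definition components :: "('v, 'e) mgraph \<Rightarrow> 'v set set" where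
  "components G = component_of G ` verts G"

definition connected_mgraph :: "('v, 'e) mgraph \<Rightarrow> bool" where
  "connected_mgraph G \<longleftrightarrow>
     verts G \<noteq> {} \<and> (\<forall>x\<in>verts G. \<forall>y\<in>verts G. (x, y) \<in> (adj_rel G)\<^sup>*)"

text \<open>
  The cycle \<open>x\<^sub>0, e\<^sub>0, x\<^sub>1, e\<^sub>1, \<dots>, x\<^sub>k\<^sub>-\<^sub>1, e\<^sub>k\<^sub>-\<^sub>1, x\<^sub>0\<close> is given by the list of its vertices and the list of
  its edges. A loop is a cycle of length one, and two parallel edges form a cycle of length two.
\<close>

definition is_cycle :: "('v, 'e) mgraph \<Rightarrow> 'v list \<Rightarrow> 'e list \<Rightarrow> bool" where
  "is_cycle G xs es \<longleftrightarrow>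
     xs \<noteq> [] \<and> length es = length xs \<and> distinct xs \<and> distinct es \<and> set es \<subseteq> edges G \<and>
     (\<forall>i<length xs. ends G (es ! i) = {xs ! i, xs ! (Suc i mod length xs)})"

definition forest :: "('v, 'e) mgraph \<Rightarrow> bool" where
  "forest G \<longleftrightarrow> (\<nexists>xs es. is_cycle G xs es)"

definition tree :: "('v, 'e) mgraph \<Rightarrow> bool" where
  "tree G \<longleftrightarrow> connected_mgraph G \<and> forest G"

definition delete_verts :: "('v, 'e) mgraph \<Rightarrow> 'v set \<Rightarrow> ('v, 'e) mgraph" where
  "delete_verts G S =
     G\<lparr>verts := verts G - S, edges := {e \<in> edges G. ends G e \<inter> S = {}}\<rparr>"

text \<open>Spanning subgraphs are identified with their edge sets.\<close>

definition spanning_subgraph :: "('v, 'e) mgraph \<Rightarrow> 'e set \<Rightarrow> ('v, 'e) mgraph" where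
  "spanning_subgraph G F = G\<lparr>edges := F\<rparr>"

definition spanning_tree :: "('v, 'e) mgraph \<Rightarrow> 'e set \<Rightarrow> bool" where
  "spanning_tree G F \<longleftrightarrow> F \<subseteq> edges G \<and> tree (spanning_subgraph G F)"

definition spanning_2_forest :: "('v, 'e) mgraph \<Rightarrow> 'e set \<Rightarrow> bool" where
  "spanning_2_forest G F \<longleftrightarrow>
     F \<subseteq> edges G \<and> forest (spanning_subgraph G F) \<and> card (components (spanning_subgraph G F)) = 2"

definition compatible ::
    "('v, 'e) mgraph \<Rightarrow> 'v set \<Rightarrow> 'v set \<Rightarrow> 'e set \<Rightarrow> bool" where
  "compatible G P1 P2 F \<longleftrightarrow>
     (\<exists>T1 T2. components (spanning_subgraph G F) = {T1, T2} \<and> T1 \<noteq> T2 \<and>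
        P1 \<subseteq> T1 \<and> P2 \<inter> T1 = {} \<and> P2 \<subseteq> T2 \<and> P1 \<inter> T2 = {})"

definition tree_forest_pairs ::
    "('v, 'e) mgraph \<Rightarrow> 'v set \<Rightarrow> 'v set \<Rightarrow> ('e set \<times> 'e set) set" where
  "tree_forest_pairs G P1 P2 =
     {(\<psi>, \<phi>). \<psi> \<union> \<phi> = edges G \<and> \<psi> \<inter> \<phi> = {} \<and>
        spanning_tree G \<psi> \<and> spanning_2_forest G \<phi> \<and> compatible G P1 P2 \<phi>}"

definition fixed_point_free_involution_on :: "'a set \<Rightarrow> ('a \<Rightarrow> 'a) \<Rightarrow> bool" where
  "fixed_point_free_involution_on A f \<longleftrightarrow> (\<forall>x\<in>A. f x \<in> A \<and> f (f x) = x \<and> f x \<noteq> x)"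

end

theory Submission
  imports Defs "HOL-Library.FuncSet" "HOL-Combinatorics.Permutations"
begin

text \<open>Let \<open>V\<close> be the vertex set of \<open>R\<close>, \<open>n = |V|\<close> and \<open>S = {a, b, c, d, e, f}\<close>. The degree sum over a
  component \<open>T\<close> of \<open>\<phi>\<close> controls \<open>|T \<inter> S|\<close>, and everything else is counting modulo 2.

  A reduced incidence matrix is unimodular, so modulo 2 the indicator of ``\<open>F\<close> is a forest with one root per
  component'' is a determinant, which equals the permanent: it is the parity of the number of bijections
  from the non-roots to \<open>F\<close> that map each vertex to an incident edge. Hence a number of partitions
  \<open>(\<psi>, \<phi>)\<close> of the edges into a spanning tree and a spanning 2-forest has the parity of the number of
  bijections from a disjoint union of two sets of rows to all edges, and this number is even as soon as some rows sum to zero. There are two such dependencies: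

  \<^item> for vertices \<open>x, y\<close>, the number of pairs whose \<open>\<phi>\<close> separates \<open>x\<close> from \<open>y\<close> is even; so for
    every \<open>Y\<close> of even size, the number of pairs for which \<open>\<phi>\<close> splits \<open>Y\<close> into two odd parts is even;
  \<^item> for fixed components \<open>{T, V - T}\<close> of \<open>\<phi>\<close>, the number of pairs in which \<open>\<psi>\<close> is not exactly the cut
    between \<open>T\<close> and \<open>V - T\<close> is even.

  For the remaining pairs the degree sum over \<open>T\<close> gives \<open>2 |T| + 3 = n + |T \<inter> S|\<close>. Among them, the pairs
  that split \<open>S\<close> as 1|5 are those that split a suitable \<open>Y\<close> (either \<open>V\<close> or \<open>V - S\<close>) into odd parts.\<close>

subsection \<open>Parity of the number of bijective systems of distinct representatives\<close>

text \<open>Reduces the existence of the involution to a parity. The orbits of such an involution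
  have two elements; conversely, any pairing of the elements defines one.\<close>

lemma fixed_point_free_involution_on_iff_even_card:
  assumes "finite A"
  shows "(\<exists>f. fixed_point_free_involution_on A f) \<longleftrightarrow> even (card A)"
proof
  have "even (card A)" if "fixed_point_free_involution_on A f" for f
    using assms that
  proof (induction A rule: finite_psubset_induct)
    case (psubset A)
    show ?case
    proof (cases "A = {}")
      case False
      then obtain x where x: "x \<in> A" by blast
      have *: "f x \<in> A" "f x \<noteq> x" "f (f x) = x"
        using x psubset.prems by (auto simp: fixed_point_free_involution_on_def)
      have "fixed_point_free_involution_on (A - {x, f x}) f"
        using psubset.prems x * unfolding fixed_point_free_involution_on_def by (metis Diff_iff insert_iff empty_iff)
      then have "even (card (A - {x, f x}))"
        using psubset.IH[of "A - {x, f x}"] x by blast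
      moreover have "card A = card (A - {x, f x}) + 2"
        using x * psubset.hyps card_Diff_subset[of "{x, f x}" A] card_mono[of A "{x, f x}"] by simp
      ultimately show ?thesis by simp
    qed simp
  qed
  then show "\<exists>f. fixed_point_free_involution_on A f \<Longrightarrow> even (card A)" by blast
next
  show "even (card A) \<Longrightarrow> \<exists>f. fixed_point_free_involution_on A f"
    using assms
  proof (induction A rule: finite_psubset_induct)
    case (psubset A)
    show ?case
    proof (cases "A = {}")
      case True
      then show ?thesis by (simp add: fixed_point_free_involution_on_def)
    next
      case False
      then obtain x where x: "x \<in> A" by blast
      have "A \<noteq> {x}" using psubset.prems by auto
      then obtain y where y: "y \<in> A" "y \<noteq> x" using x by blast
      have c: "card A = card (A - {x, y}) + 2"
        using x y psubset.hyps card_Diff_subset[of "{x, y}" A] card_mono[of A "{x, y}"] by simp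
      obtain f where f: "fixed_point_free_involution_on (A - {x, y}) f"
        using psubset.IH[of "A - {x, y}"] x c psubset.prems by auto
      have "fixed_point_free_involution_on A (f(x := y, y := x))"
        using f x y unfolding fixed_point_free_involution_on_def by auto
      then show ?thesis by blast
    qed
  qed
qed

text \<open>The number of these functions is the permanent of the 0/1 matrix with rows
  \<open>I\<close>, columns \<open>F\<close> and row supports \<open>\<rho>\<close>. Extensionality
  makes each bijection count once.\<close>

definition sdrs :: "'i set \<Rightarrow> ('i \<Rightarrow> 'e set) \<Rightarrow> 'e set \<Rightarrow> ('i \<Rightarrow> 'e) set" where
  "sdrs I \<rho> F = {\<sigma> \<in> extensional I. bij_betw \<sigma> I F \<and> (\<forall>i\<in>I. \<sigma> i \<in> \<rho> i)}"

lemma finite_bij_extensional: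
  assumes "finite I" "finite F"
  shows "finite {\<sigma> \<in> extensional I. bij_betw \<sigma> I F}"
  by (rule finite_subset[OF _ finite_PiE[of I "\<lambda>_. F"]])
    (use assms in \<open>auto simp: PiE_def bij_betw_def\<close>)

lemma finite_sdrs: "finite I \<Longrightarrow> finite F \<Longrightarrow> finite (sdrs I \<rho> F)"
  by (rule finite_subset[OF _ finite_bij_extensional[of I F]]) (auto simp: sdrs_def)

section \<open>Rules for permanents modulo 2\<close>

lemma card_sdrs_empty: "card (sdrs {} \<rho> F) = (if F = {} then 1 else 0)"
proof -
  have "sdrs {} \<rho> F = (if F = {} then {\<lambda>_. undefined} else {})"
    by (auto simp: sdrs_def bij_betw_def extensional_def)
  then show ?thesis by simp
qed

text \<open>Expansion along the column \<open>e\<close>, whose only nonzero entry is in row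
  \<open>u\<close>: a bijection onto \<open>F\<close> must hit \<open>e\<close>, and can do so only
  at \<open>u\<close>.\<close>

lemma card_sdrs_forced:
  assumes "u \<in> I" "e \<in> F" "e \<in> \<rho> u" "\<And>i. i \<in> I \<Longrightarrow> e \<in> \<rho> i \<Longrightarrow> i = u"
  shows "card (sdrs I \<rho> F) = card (sdrs (I - {u}) \<rho> (F - {e}))"
proof (rule bij_betw_same_card)
  have eq: "\<sigma> u = e" if "\<sigma> \<in> sdrs I \<rho> F" for \<sigma>
    using that assms unfolding sdrs_def bij_betw_def by blast
  show "bij_betw (\<lambda>\<sigma>. \<sigma>(u := undefined)) (sdrs I \<rho> F) (sdrs (I - {u}) \<rho> (F - {e}))"
  proof (rule bij_betw_byWitness[where f' = "\<lambda>\<tau>. \<tau>(u := e)"])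
    show "\<forall>\<sigma>\<in>sdrs I \<rho> F. \<sigma>(u := undefined, u := e) = \<sigma>"
      using eq by (simp add: fun_eq_iff)
    show "\<forall>\<tau>\<in>sdrs (I - {u}) \<rho> (F - {e}). \<tau>(u := e, u := undefined) = \<tau>"
      by (simp add: sdrs_def extensional_def fun_eq_iff)
    show "(\<lambda>\<sigma>. \<sigma>(u := undefined)) ` sdrs I \<rho> F \<subseteq> sdrs (I - {u}) \<rho> (F - {e})"
    proof (rule image_subsetI)
      fix \<sigma> assume \<sigma>: "\<sigma> \<in> sdrs I \<rho> F"
      then have "bij_betw \<sigma> (I - {u}) (F - {e})"
        using eq[OF \<sigma>] assms(1,2) bij_betw_DiffI[of \<sigma> I F "{u}" "{e}"] by (simp add: sdrs_def)
      then have "bij_betw (\<sigma>(u := undefined)) (I - {u}) (F - {e})"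
        by (subst bij_betw_cong[of _ _ \<sigma>]) auto
      then show "\<sigma>(u := undefined) \<in> sdrs (I - {u}) \<rho> (F - {e})"
        using \<sigma> by (auto simp: sdrs_def extensional_def)
    qed
    show "(\<lambda>\<tau>. \<tau>(u := e)) ` sdrs (I - {u}) \<rho> (F - {e}) \<subseteq> sdrs I \<rho> F"
    proof (rule image_subsetI)
      fix \<tau> assume \<tau>: "\<tau> \<in> sdrs (I - {u}) \<rho> (F - {e})"
      then have "bij_betw (\<tau>(u := e)) (I - {u}) (F - {e})"
        by (subst bij_betw_cong[of _ _ \<tau>]) (auto simp: sdrs_def)
      moreover have "bij_betw (\<tau>(u := e)) {u} {e}" by simp
      ultimately have "bij_betw (\<tau>(u := e)) (I - {u} \<union> {u}) (F - {e} \<union> {e})"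
        by (rule bij_betw_combine) auto
      then have "bij_betw (\<tau>(u := e)) I F"
        using assms(1,2) by (simp add: insert_absorb)
      then show "\<tau>(u := e) \<in> sdrs I \<rho> F"
        using \<tau> assms(1,3) by (auto simp: sdrs_def extensional_def)
    qed
  qed
qed

text \<open>The rows in \<open>X\<close> sum to zero modulo 2. The proof follows the one for
  determinants: put each row of \<open>X\<close> in turn in place of row \<open>u\<close> and add
  up.\<close>

lemma even_card_sdrs:
  assumes fin: "finite I" "finite F" and X: "X \<subseteq> I" "X \<noteq> {}"
    and even: "\<And>e. e \<in> F \<Longrightarrow> even (card {x \<in> X. e \<in> \<rho> x})"
  shows "even (card (sdrs I \<rho> F))"
proof -
  obtain u where u: "u \<in> X" using X by blast
  \<comment> \<open>\<open>B\<close> leaves row \<open>u\<close> unconstrained, and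
    \<open>A x\<close> puts row \<open>x\<close> in its place; \<open>A u\<close> is the original
    set.\<close>
  define B where "B = {\<sigma> \<in> extensional I. bij_betw \<sigma> I F \<and> (\<forall>i\<in>I - {u}. \<sigma> i \<in> \<rho> i)}"
  define A where "A x = {\<sigma> \<in> B. \<sigma> u \<in> \<rho> x}" for x
  have finB: "finite B"
    by (rule finite_subset[OF _ finite_bij_extensional[OF fin]]) (auto simp: B_def)
  have finX: "finite X" using X fin finite_subset by blast
  have "(\<Sum>x\<in>X. card (A x)) = (\<Sum>\<sigma>\<in>B. card {x \<in> X. \<sigma> u \<in> \<rho> x})"
    unfolding A_def by (rule sum_multicount_gen) (use finX finB in auto)
  also have "even \<dots>"
  proof (rule dvd_sum)
    fix \<sigma> assume "\<sigma> \<in> B"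
    then have "\<sigma> u \<in> F" using u X by (auto simp: B_def bij_betw_def)
    then show "even (card {x \<in> X. \<sigma> u \<in> \<rho> x})" by (rule even)
  qed
  finally have sum: "even (\<Sum>x\<in>X. card (A x))" .
  \<comment> \<open>Rows \<open>u\<close> and \<open>x\<close> now coincide, so exchanging the
    values at \<open>u\<close> and \<open>x\<close> stays inside \<open>A x\<close>; injectivity
    excludes fixed points.\<close>
  have "even (card (A x))" if x: "x \<in> X - {u}" for x
  proof -
    have tr: "transpose u x permutes I" using u x X by (auto intro: permutes_swap_id)
    have "fixed_point_free_involution_on (A x) (\<lambda>\<sigma>. \<sigma> \<circ> transpose u x)"
      unfolding fixed_point_free_involution_on_def
    proof (intro ballI conjI)
      fix \<sigma> assume \<sigma>: "\<sigma> \<in> A x"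
      have "bij_betw (\<sigma> \<circ> transpose u x) I F"
        using \<sigma> tr by (auto simp: A_def B_def intro!: bij_betw_trans[OF permutes_imp_bij])
      moreover have "\<sigma> \<circ> transpose u x \<in> extensional I"
        using \<sigma> u x X by (auto simp: A_def B_def extensional_def transpose_def)
      moreover have "\<sigma> x \<in> \<rho> x" "\<sigma> u \<in> \<rho> x" using \<sigma> x X by (auto simp: A_def B_def)
      ultimately show "\<sigma> \<circ> transpose u x \<in> A x"
        using \<sigma> unfolding A_def B_def by (auto simp: transpose_def)
      show "\<sigma> \<circ> transpose u x \<circ> transpose u x = \<sigma>" by (simp add: comp_assoc)
      have "\<sigma> u \<noteq> \<sigma> x"
        using \<sigma> u x X unfolding A_def B_def bij_betw_def inj_on_def by blast
      then show "\<sigma> \<circ> transpose u x \<noteq> \<sigma>"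
        by (metis comp_apply transpose_apply_first)
    qed
    moreover have "finite (A x)" using finB by (auto simp: A_def)
    ultimately show ?thesis using fixed_point_free_involution_on_iff_even_card by blast
  qed
  then have "even (\<Sum>x\<in>X - {u}. card (A x))" by (intro dvd_sum) auto
  then have "even (card (A u))"
    using sum u finX by (simp add: sum.remove)
  moreover have "A u = sdrs I \<rho> F" using u X by (auto simp: A_def B_def sdrs_def)
  ultimately show ?thesis by simp
qed

text \<open>Laplace expansion along a block of rows, without signs: \<open>\<psi>\<close> is the set
  of columns used by the rows in \<open>I\<close>.\<close>

lemma card_sdrs_Plus:
  assumes "finite I" "finite J" "finite F"
  shows "card (sdrs (I <+> J) (case_sum \<rho> \<tau>) F) =
    (\<Sum>\<psi>\<in>Pow F. card (sdrs I \<rho> \<psi>) * card (sdrs J \<tau> (F - \<psi>)))"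
proof -
  have mem_Plus: "Inl i \<in> I <+> J \<longleftrightarrow> i \<in> I" "Inr j \<in> I <+> J \<longleftrightarrow> j \<in> J" for i j
    by blast+
  let ?P = "\<lambda>\<psi>. sdrs I \<rho> \<psi> \<times> sdrs J \<tau> (F - \<psi>)"
  let ?c = "\<lambda>(\<sigma>, \<sigma>'). case_sum \<sigma> \<sigma>'"
  have eq: "sdrs (I <+> J) (case_sum \<rho> \<tau>) F = ?c ` (\<Union>\<psi>\<in>Pow F. ?P \<psi>)"
  proof (intro equalityI subsetI)
    fix \<sigma> assume \<sigma>: "\<sigma> \<in> sdrs (I <+> J) (case_sum \<rho> \<tau>) F"
    have out: "\<sigma> (Inl i) = undefined" if "i \<notin> I" for i
      using that \<sigma> by (simp add: sdrs_def extensional_def mem_Plus)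
    have out': "\<sigma> (Inr j) = undefined" if "j \<notin> J" for j
      using that \<sigma> by (simp add: sdrs_def extensional_def mem_Plus)
    have inj: "inj_on \<sigma> (I <+> J)" and im: "\<sigma> ` (I <+> J) = F"
      using \<sigma> by (simp_all add: sdrs_def bij_betw_def)
    have "\<forall>i\<in>I <+> J. \<sigma> i \<in> case_sum \<rho> \<tau> i"
      using \<sigma> by (simp add: sdrs_def)
    note all = bspec[OF this]
    have mem: "\<sigma> (Inl i) \<in> \<rho> i" if "i \<in> I" for i
      using all[OF InlI[OF that]] by simp
    have mem': "\<sigma> (Inr j) \<in> \<tau> j" if "j \<in> J" for j
      using all[OF InrI[OF that]] by simp
    have "inj_on (\<sigma> \<circ> Inl) I" "inj_on (\<sigma> \<circ> Inr) J"
      by (rule comp_inj_on, simp, rule inj_on_subset[OF inj], blast)+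
    moreover have un: "(\<sigma> \<circ> Inl) ` I \<union> (\<sigma> \<circ> Inr) ` J = F"
      using im by (simp add: Plus_def image_Un image_comp)
    moreover have "(\<sigma> \<circ> Inl) ` I \<inter> (\<sigma> \<circ> Inr) ` J = {}"
    proof -
      have "\<sigma> (Inl i) \<noteq> \<sigma> (Inr j)" if "i \<in> I" "j \<in> J" for i j
        using inj_onD[OF inj, of "Inl i" "Inr j"] that by blast
      then show ?thesis by auto
    qed
    ultimately have "\<sigma> \<circ> Inl \<in> sdrs I \<rho> ((\<sigma> \<circ> Inl) ` I)" "\<sigma> \<circ> Inr \<in> sdrs J \<tau> (F - (\<sigma> \<circ> Inl) ` I)"
      unfolding sdrs_def bij_betw_def extensional_def using out out' mem mem' by (simp_all, blast)
    moreover have "\<sigma> = ?c (\<sigma> \<circ> Inl, \<sigma> \<circ> Inr)" by (simp add: fun_eq_iff split: sum.split)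
    ultimately show "\<sigma> \<in> ?c ` (\<Union>\<psi>\<in>Pow F. ?P \<psi>)" using un by blast
  next
    fix \<sigma> assume "\<sigma> \<in> ?c ` (\<Union>\<psi>\<in>Pow F. ?P \<psi>)"
    then obtain p \<psi> where "\<psi> \<in> Pow F" "p \<in> ?P \<psi>" "\<sigma> = ?c p" by blast
    then obtain \<alpha> \<beta> where *: "\<psi> \<subseteq> F" "\<alpha> \<in> sdrs I \<rho> \<psi>" "\<beta> \<in> sdrs J \<tau> (F - \<psi>)" "\<sigma> = case_sum \<alpha> \<beta>"
      by (cases p) (simp, blast)
    have im: "\<alpha> ` I = \<psi>" "\<beta> ` J = F - \<psi>" and inj: "inj_on \<alpha> I" "inj_on \<beta> J"
      using * by (simp_all add: sdrs_def bij_betw_def)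
    have "\<sigma> ` (I <+> J) = \<alpha> ` I \<union> \<beta> ` J"
      unfolding *(4) Plus_def image_Un image_comp case_sum_o_inj ..
    then have "\<sigma> ` (I <+> J) = F" using *(1) by (simp add: im Un_absorb1)
    moreover have "inj_on \<sigma> (I <+> J)"
    proof (rule inj_onI)
      fix x y assume xy: "x \<in> I <+> J" "y \<in> I <+> J" "\<sigma> x = \<sigma> y"
      have "\<alpha> i \<noteq> \<beta> j" if "i \<in> I" "j \<in> J" for i j
        using imageI[OF that(1), of \<alpha>] imageI[OF that(2), of \<beta>] unfolding im by auto
      then show "x = y"
        using xy inj unfolding *(4) Plus_def by (elim UnE imageE) (simp_all, metis inj_onD, metis, metis inj_onD)
    qed
    moreover have "\<sigma> \<in> extensional (I <+> J)"
      unfolding extensional_def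
    proof (intro CollectI allI impI)
      fix x assume "x \<notin> I <+> J"
      then show "\<sigma> x = undefined"
        using *(2,3) mem_Plus unfolding *(4) by (cases x) (simp_all add: sdrs_def extensional_def)
    qed
    moreover have "\<forall>x\<in>I <+> J. \<sigma> x \<in> case_sum \<rho> \<tau> x"
      using *(2,3) unfolding *(4) Plus_def by (auto simp: sdrs_def)
    ultimately show "\<sigma> \<in> sdrs (I <+> J) (case_sum \<rho> \<tau>) F"
      by (simp add: sdrs_def bij_betw_def)
  qed
  have inj: "inj ?c"
  proof (rule injI)
    fix p q assume "?c p = ?c q"
    then have eq: "case_sum (fst p) (snd p) = case_sum (fst q) (snd q)" by (simp add: case_prod_beta)
    show "p = q"
      using arg_cong[OF eq, of "\<lambda>h. h \<circ> Inl"] arg_cong[OF eq, of "\<lambda>h. h \<circ> Inr"]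
      unfolding case_sum_o_inj by (rule prod_eqI)
  qed
  have "card (sdrs (I <+> J) (case_sum \<rho> \<tau>) F) = card (\<Union>\<psi>\<in>Pow F. ?P \<psi>)"
    unfolding eq by (rule card_image[OF inj_on_subset[OF inj subset_UNIV]])
  also have "\<dots> = (\<Sum>\<psi>\<in>Pow F. card (?P \<psi>))"
  proof (rule card_UN_disjoint)
    show "\<forall>\<psi>\<in>Pow F. finite (?P \<psi>)"
      using assms finite_subset by (blast intro: finite_sdrs finite_cartesian_product)
    have "\<sigma> \<notin> sdrs I \<rho> \<psi>'" if "\<sigma> \<in> sdrs I \<rho> \<psi>" "\<psi> \<noteq> \<psi>'" for \<sigma> \<psi> \<psi>'
      using that by (simp add: sdrs_def bij_betw_def)
    then show "\<forall>\<psi>\<in>Pow F. \<forall>\<psi>'\<in>Pow F. \<psi> \<noteq> \<psi>' \<longrightarrow> ?P \<psi> \<inter> ?P \<psi>' = {}"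
      by blast
  qed (use assms in auto)
  finally show ?thesis by (simp add: card_cartesian_product)
qed

text \<open>A product is odd exactly if both factors are, so this count has the parity of the
  Laplace sum, that is, of the permanent of the stacked matrix.\<close>

lemma even_card_partitions_into_odd_sdrs:
  assumes fin: "finite I" "finite J" "finite F" and X: "X \<subseteq> I <+> J" "X \<noteq> {}"
    and "\<And>e. e \<in> F \<Longrightarrow> even (card {x \<in> X. e \<in> case_sum \<rho> \<tau> x})"
  shows "even (card {(\<psi>, \<phi>). \<psi> \<union> \<phi> = F \<and> \<psi> \<inter> \<phi> = {} \<and>
    odd (card (sdrs I \<rho> \<psi>)) \<and> odd (card (sdrs J \<tau> \<phi>))})" (is "even (card ?A)")
proof -
  let ?f = "\<lambda>\<psi>. card (sdrs I \<rho> \<psi>) * card (sdrs J \<tau> (F - \<psi>))"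
  have "even (card (sdrs (I <+> J) (case_sum \<rho> \<tau>) F))"
    by (rule even_card_sdrs) (use assms in auto)
  then have "even (card {\<psi> \<in> Pow F. odd (?f \<psi>)})"
    using fin by (simp add: card_sdrs_Plus even_sum_iff)
  moreover have "?A = (\<lambda>\<psi>. (\<psi>, F - \<psi>)) ` {\<psi> \<in> Pow F. odd (?f \<psi>)}"
  proof (intro equalityI subsetI)
    fix p assume "p \<in> ?A"
    then obtain \<psi> \<phi> where p: "p = (\<psi>, \<phi>)" "\<psi> \<union> \<phi> = F" "\<psi> \<inter> \<phi> = {}"
      "odd (card (sdrs I \<rho> \<psi>))" "odd (card (sdrs J \<tau> \<phi>))" by blast
    then have "\<phi> = F - \<psi>" "\<psi> \<in> Pow F" by blast+
    then show "p \<in> (\<lambda>\<psi>. (\<psi>, F - \<psi>)) ` {\<psi> \<in> Pow F. odd (?f \<psi>)}" using p by simp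
  qed auto
  moreover have "inj_on (\<lambda>\<psi>. (\<psi>, F - \<psi>)) {\<psi> \<in> Pow F. odd (?f \<psi>)}" by (auto simp: inj_on_def)
  ultimately show ?thesis by (simp add: card_image)
qed

subsection \<open>Rooted forests\<close>

definition reach :: "('v, 'e) mgraph \<Rightarrow> 'e set \<Rightarrow> ('v \<times> 'v) set" where
  "reach R F = (adj_rel (spanning_subgraph R F))\<^sup>*"

lemma adj_rel_spanning_subgraph:
  "adj_rel (spanning_subgraph R F) = {(x, y). \<exists>e\<in>F. ends R e = {x, y}}"
  by (simp add: adj_rel_def spanning_subgraph_def)

lemma reach_refl [simp]: "(x, x) \<in> reach R F"
  by (simp add: reach_def)

lemma reach_trans: "(x, y) \<in> reach R F \<Longrightarrow> (y, z) \<in> reach R F \<Longrightarrow> (x, z) \<in> reach R F"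
  by (simp add: reach_def)

lemma reach_sym: "(x, y) \<in> reach R F \<Longrightarrow> (y, x) \<in> reach R F"
  unfolding reach_def
  by (rule symD[OF sym_rtrancl]) (auto simp: sym_def adj_rel_spanning_subgraph insert_commute)

lemma reach_edge: "e \<in> F \<Longrightarrow> ends R e = {x, y} \<Longrightarrow> (x, y) \<in> reach R F"
  unfolding reach_def adj_rel_spanning_subgraph by blast

lemma reach_mono: "F \<subseteq> F' \<Longrightarrow> reach R F \<subseteq> reach R F'"
  unfolding reach_def adj_rel_spanning_subgraph by (rule rtrancl_mono) blast

lemma reach_closed:
  assumes "(x, y) \<in> reach R F" "x \<in> X"
    and "\<And>e a b. e \<in> F \<Longrightarrow> ends R e = {a, b} \<Longrightarrow> a \<in> X \<Longrightarrow> b \<in> X"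
  shows "y \<in> X"
  using assms(1,2) unfolding reach_def
proof (induction rule: rtrancl_induct)
  case (step y z)
  then show ?case using assms(3) by (auto simp: adj_rel_spanning_subgraph)
qed

text \<open>A walk can be shortened until it uses \<open>e\<close> at most once, in one of the two
  directions.\<close>

lemma reach_insert:
  assumes e: "ends R e = {u, z}"
  shows "(x, y) \<in> reach R (insert e F) \<longleftrightarrow> (x, y) \<in> reach R F \<or>
    (x, u) \<in> reach R F \<and> (z, y) \<in> reach R F \<or> (x, z) \<in> reach R F \<and> (u, y) \<in> reach R F"
    (is "?l \<longleftrightarrow> ?r y")
proof
  assume ?l
  then have "y \<in> Collect ?r"
  proof (rule reach_closed)
    show "x \<in> Collect ?r" by simp
    fix f a b assume f: "f \<in> insert e F" "ends R f = {a, b}" and "a \<in> Collect ?r"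
    then have a: "?r a" by simp
    show "b \<in> Collect ?r"
    proof (cases "f \<in> F")
      case True
      then show ?thesis using a reach_edge[OF True f(2)] by (auto intro: reach_trans)
    next
      case False
      then have "a = u \<and> b = z \<or> a = z \<and> b = u" using f e by (auto simp: doubleton_eq_iff)
      then show ?thesis using a reach_refl[of _ R F] by auto
    qed
  qed
  then show "?r y" by simp
next
  assume "?r y"
  moreover have "(u, z) \<in> reach R (insert e F)" "(z, u) \<in> reach R (insert e F)"
    using reach_edge[of e "insert e F" R] e by (auto simp: insert_commute)
  ultimately show ?l
    using reach_mono[OF subset_insertI, of R F e] by (meson reach_trans subsetD)
qed

section \<open>Paths and cycles\<close>

lemma rtrancl_imp_distinct_successively:
  assumes "(x, y) \<in> r\<^sup>*"
  shows "\<exists>xs. xs \<noteq> [] \<and> hd xs = x \<and> last xs = y \<and> distinct xs \<and> successively (\<lambda>a b. (a, b) \<in> r) xs"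
  using assms
proof (induction rule: converse_rtrancl_induct)
  case base
  then show ?case by (intro exI[of _ "[y]"]) simp
next
  case (step x x')
  then obtain xs where xs: "xs \<noteq> []" "hd xs = x'" "last xs = y" "distinct xs"
    "successively (\<lambda>a b. (a, b) \<in> r) xs" by blast
  show ?case
  proof (cases "x \<in> set xs")
    \<comment> \<open>The walk returns to \<open>x\<close>: everything before that return is cut
      off.\<close>
    case True
    then obtain ys zs where "xs = ys @ x # zs" by (meson split_list)
    then show ?thesis using xs by (intro exI[of _ "x # zs"]) (auto simp: successively_append_iff)
  next
    case False
    then show ?thesis using xs step(1)
      by (intro exI[of _ "x # xs"]) (auto simp: successively_Cons)
  qed
qed

text \<open>The edge \<open>e\<close> closes a simple path from \<open>u\<close> to
  \<open>z\<close>. For \<open>u = z\<close> the path has one vertex and the cycle is the loop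
  \<open>e\<close>.\<close>

lemma reach_imp_cycle:
  assumes "(u, z) \<in> reach R F" "e \<notin> F" and e: "ends R e = {u, z}"
  shows "\<exists>xs es. is_cycle (spanning_subgraph R (insert e F)) xs es"
proof -
  obtain xs where xs: "xs \<noteq> []" "hd xs = u" "last xs = z" "distinct xs"
    "successively (\<lambda>a b. (a, b) \<in> adj_rel (spanning_subgraph R F)) xs"
    using rtrancl_imp_distinct_successively assms(1) unfolding reach_def by metis
  let ?k = "length xs - 1"
  have "\<exists>f\<in>F. ends R f = {xs ! i, xs ! Suc i}" if "i < ?k" for i
    using xs(5) that by (auto simp: successively_conv_nth adj_rel_spanning_subgraph)
  then obtain g where g: "\<And>i. i < ?k \<Longrightarrow> g i \<in> F" "\<And>i. i < ?k \<Longrightarrow> ends R (g i) = {xs ! i, xs ! Suc i}"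
    by metis
  have inj: "i = j" if "i < ?k" "j < ?k" "g i = g j" for i j
  proof -
    have "{xs ! i, xs ! Suc i} = {xs ! j, xs ! Suc j}" using g that by metis
    then show ?thesis
      using that xs(4) by (auto simp: doubleton_eq_iff nth_eq_iff_index_eq)
  qed
  let ?es = "map g [0..<?k] @ [e]"
  have "is_cycle (spanning_subgraph R (insert e F)) xs ?es"
    unfolding is_cycle_def
  proof (intro conjI allI impI)
    show "distinct ?es" using inj g(1) assms(2) by (auto simp: distinct_map inj_on_def)
    show "set ?es \<subseteq> edges (spanning_subgraph R (insert e F))"
      using g(1) by (auto simp: spanning_subgraph_def)
    fix i assume i: "i < length xs"
    show "ends (spanning_subgraph R (insert e F)) (?es ! i) = {xs ! i, xs ! (Suc i mod length xs)}"
    proof (cases "i = ?k")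
      case True
      then have "Suc i mod length xs = 0" using xs(1) by simp
      then show ?thesis using True e xs(1-3)
        by (auto simp: spanning_subgraph_def nth_append hd_conv_nth last_conv_nth)
    next
      case False
      then have "i < ?k" using i by simp
      then show ?thesis using g(2)[of i] by (simp add: spanning_subgraph_def nth_append)
    qed
  qed (use xs in auto)
  then show ?thesis by blast
qed

text \<open>The cycle must use \<open>e\<close>, since it is not a cycle in \<open>F\<close>; what
  remains of it joins the ends of \<open>e\<close> within \<open>F\<close>.\<close>

lemma cycle_imp_reach:
  assumes cyc: "is_cycle (spanning_subgraph R (insert e F)) xs es"
    and not: "\<not> is_cycle (spanning_subgraph R F) xs es"
  shows "\<exists>u z. ends R e = {u, z} \<and> (u, z) \<in> reach R F"
proof -
  let ?k = "length xs"
  have len: "length es = ?k" and k: "?k > 0" and dist: "distinct es" and sub: "set es \<subseteq> insert e F"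
    and ends: "\<And>i. i < ?k \<Longrightarrow> ends R (es ! i) = {xs ! i, xs ! (Suc i mod ?k)}"
    using cyc by (auto simp: is_cycle_def spanning_subgraph_def)
  have "e \<in> set es" using cyc not by (auto simp: is_cycle_def spanning_subgraph_def)
  then obtain i where i: "i < ?k" "es ! i = e" using len by (metis in_set_conv_nth)
  \<comment> \<open>Positions counted from the vertex just after \<open>e\<close>, so that
    \<open>e\<close> is left only from the last one, \<open>p (?k - 1) = i\<close>.\<close>
  define p where "p j = (Suc i + j) mod ?k" for j
  have reach: "j < ?k \<Longrightarrow> (xs ! p 0, xs ! p j) \<in> reach R F" for j
  proof (induction j)
    case (Suc j)
    have lt: "p j < ?k" using k by (simp add: p_def)
    have "p j \<noteq> i"
    proof
      assume "p j = i"
      moreover have "p j = (if Suc i + j < ?k then Suc i + j else Suc i + j - ?k)"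
        using Suc.prems i by (simp add: p_def le_mod_geq)
      ultimately show False using Suc.prems by (simp split: if_splits)
    qed
    then have "es ! p j \<noteq> e" using i lt dist len nth_eq_iff_index_eq by metis
    moreover have "es ! p j \<in> set es" using lt len by simp
    ultimately have "es ! p j \<in> F" using sub by blast
    moreover have "Suc (p j) mod ?k = p (Suc j)" by (simp add: p_def mod_Suc_eq)
    ultimately have "(xs ! p j, xs ! p (Suc j)) \<in> reach R F"
      using ends[OF lt] by (auto intro: reach_edge)
    then show ?case using Suc by (auto intro: reach_trans)
  qed simp
  have "p (?k - 1) = i" using k i by (simp add: p_def)
  moreover have "p 0 = Suc i mod ?k" by (simp add: p_def)
  ultimately have "ends R e = {xs ! p 0, xs ! p (?k - 1)}"
    using ends[OF i(1)] i(2) by (simp add: insert_commute)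
  then show ?thesis using reach[of "?k - 1"] k by auto
qed

text \<open>A single root in the graph describes spanning trees, two roots the spanning 2-forests
  separating them.\<close>

definition rooted_forest :: "('v, 'e) mgraph \<Rightarrow> 'v set \<Rightarrow> 'e set \<Rightarrow> bool" where
  "rooted_forest R Q F \<longleftrightarrow> forest (spanning_subgraph R F) \<and>
     (\<forall>x\<in>verts R. \<exists>!q. q \<in> Q \<and> (x, q) \<in> reach R F)"

text \<open>Loops are excluded: their incidence vector is zero modulo 2.\<close>

definition incident :: "('v, 'e) mgraph \<Rightarrow> 'v \<Rightarrow> 'e set" where
  "incident R v = {e. v \<in> ends R e \<and> card (ends R e) = 2}"

lemma forest_mono:
  "forest (spanning_subgraph R F') \<Longrightarrow> F \<subseteq> F' \<Longrightarrow> forest (spanning_subgraph R F)"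
  unfolding forest_def is_cycle_def spanning_subgraph_def by (simp, blast)

text \<open>Deleting \<open>e\<close> splits the tree rooted at \<open>z\<close>, and the piece
  without \<open>z\<close> gets the root \<open>u\<close>. Conversely, \<open>e\<close> joins two
  different trees, which creates no cycle and leaves \<open>z\<close> as the only root.\<close>

lemma rooted_forest_insert:
  assumes e: "e \<notin> F" "ends R e = {u, z}" and z: "z \<in> Q" "z \<in> verts R" and u: "u \<notin> Q" "u \<in> verts R"
  shows "rooted_forest R Q (insert e F) \<longleftrightarrow> rooted_forest R (insert u Q) F"
proof
  assume L: "rooted_forest R Q (insert e F)"
  have nuz: "(u, z) \<notin> reach R F"
    using reach_imp_cycle[OF _ e] L by (auto simp: rooted_forest_def forest_def)
  have "\<exists>!q. q \<in> insert u Q \<and> (x, q) \<in> reach R F" if x: "x \<in> verts R" for x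
  proof -
    obtain q where q: "q \<in> Q" "(x, q) \<in> reach R (insert e F)"
      and uniq: "\<And>q'. q' \<in> Q \<Longrightarrow> (x, q') \<in> reach R (insert e F) \<Longrightarrow> q' = q"
      using L x unfolding rooted_forest_def by blast
    show ?thesis
    proof (cases "(x, u) \<in> reach R F")
      case True
      have "(x, z) \<in> reach R (insert e F)"
        using True by (simp add: reach_insert[OF e(2)])
      then have qz: "q = z" using uniq z by blast
      have "q' = u" if "q' \<in> insert u Q" "(x, q') \<in> reach R F" for q'
      proof (rule ccontr)
        assume "q' \<noteq> u"
        then have "q' = z" using that uniq[of q'] qz by (simp add: reach_insert[OF e(2)])
        then show False using that True nuz by (meson reach_trans reach_sym)
      qed
      then show ?thesis using True by blast
    next
      case False
      then have "(x, q) \<in> reach R F \<or> (x, z) \<in> reach R F"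
        using q by (auto simp: reach_insert[OF e(2)])
      then have "\<exists>q'\<in>Q. (x, q') \<in> reach R F" using q z by blast
      moreover have "q' = q" if "q' \<in> Q" "(x, q') \<in> reach R F" for q'
        using that uniq[of q'] by (simp add: reach_insert[OF e(2)])
      ultimately show ?thesis using False by (metis insert_iff)
    qed
  qed
  then show "rooted_forest R (insert u Q) F"
    using L forest_mono[of R "insert e F" F] by (auto simp: rooted_forest_def)
next
  assume L: "rooted_forest R (insert u Q) F"
  have ex: "\<exists>!q. q \<in> insert u Q \<and> (x, q) \<in> reach R F" if "x \<in> verts R" for x
    using L that by (simp add: rooted_forest_def)
  have uz: "(u, q) \<notin> reach R F" if "q \<in> Q" for q
    using ex[OF u(2)] u that reach_refl[of u R F] by blast
  have zq: "q = z" if "q \<in> Q" "(z, q) \<in> reach R F" for q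
    using ex[OF z(2)] z that reach_refl[of z R F] by blast
  have "\<exists>!q. q \<in> Q \<and> (x, q) \<in> reach R (insert e F)" if x: "x \<in> verts R" for x
  proof -
    obtain q where q: "q \<in> insert u Q" "(x, q) \<in> reach R F"
      and uniq: "\<And>q'. q' \<in> insert u Q \<Longrightarrow> (x, q') \<in> reach R F \<Longrightarrow> q' = q"
      using ex[OF x] by blast
    show ?thesis
    proof (cases "q = u")
      case True
      have "(x, z) \<in> reach R (insert e F)" using q True by (simp add: reach_insert[OF e(2)])
      moreover have "q' = z" if "q' \<in> Q" "(x, q') \<in> reach R (insert e F)" for q'
        using that(2) unfolding reach_insert[OF e(2)]
        using uniq[of q'] uniq[of z] that(1) True u z uz zq by blast
      ultimately show ?thesis using z by blast
    next
      case False
      have nu: "(x, u) \<notin> reach R F" using uniq[of u] False by blast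
      have "(x, q) \<in> reach R (insert e F)" using q by (simp add: reach_insert[OF e(2)])
      moreover have "q' = q" if "q' \<in> Q" "(x, q') \<in> reach R (insert e F)" for q'
        using that(2) unfolding reach_insert[OF e(2)]
        using uniq[of q'] that(1) nu uz by blast
      ultimately show ?thesis using q False by blast
    qed
  qed
  moreover have "forest (spanning_subgraph R (insert e F))"
    unfolding forest_def
  proof clarify
    fix xs es assume "is_cycle (spanning_subgraph R (insert e F)) xs es"
    moreover have "\<not> is_cycle (spanning_subgraph R F) xs es"
      using L by (auto simp: rooted_forest_def forest_def)
    ultimately obtain a b where "{u, z} = {a, b}" "(a, b) \<in> reach R F"
      using cycle_imp_reach e by metis
    then have "(u, z) \<in> reach R F" by (auto simp: doubleton_eq_iff intro: reach_sym)
    then show False using uz z by blast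
  qed
  ultimately show "rooted_forest R Q (insert e F)" by (simp add: rooted_forest_def)
qed

text \<open>Base case for the induction on the number of non-roots: an edge would be a loop, hence a
  cycle, or would connect two roots.\<close>

lemma rooted_forest_all_roots:
  assumes R: "finite_mgraph R" and F: "F \<subseteq> edges R"
  shows "rooted_forest R (verts R) F \<longleftrightarrow> F = {}"
proof
  assume L: "rooted_forest R (verts R) F"
  show "F = {}"
  proof (rule ccontr)
    assume "F \<noteq> {}"
    then obtain e where e: "e \<in> F" by blast
    then have "ends R e \<subseteq> verts R" "card (ends R e) \<in> {1, 2}"
      using R F by (auto simp: finite_mgraph_def)
    then consider x where "ends R e = {x}" | x y where "ends R e = {x, y}" "x \<noteq> y" "x \<in> verts R" "y \<in> verts R"
      by (auto simp: card_2_iff card_1_singleton_iff)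
    then show False
    proof cases
      case 1
      then have "\<exists>xs es. is_cycle (spanning_subgraph R (insert e (F - {e}))) xs es"
        by (intro reach_imp_cycle[of x x]) auto
      then show False using L e by (auto simp: rooted_forest_def forest_def insert_absorb)
    next
      case 2
      have "(x, y) \<in> reach R F" using e 2 by (auto intro: reach_edge)
      then show False using L 2 reach_refl[of x R F] unfolding rooted_forest_def by blast
    qed
  qed
next
  assume "F = {}"
  moreover have "reach R {} = Id" by (simp add: reach_def adj_rel_spanning_subgraph)
  ultimately show "rooted_forest R (verts R) F"
    by (auto simp: rooted_forest_def forest_def is_cycle_def spanning_subgraph_def)
qed

text \<open>An edge \<open>e\<close> joining a root to a non-root \<open>u\<close> can only be assigned to \<open>u\<close>; deleting \<open>e\<close> and
  declaring \<open>u\<close> a root changes neither side. If no such edge exists, every edge meets the non-roots in an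
  even number of ends.\<close>

lemma odd_card_sdrs_incident_iff:
  assumes R: "finite_mgraph R" and "F \<subseteq> edges R" "Q \<subseteq> verts R"
  shows "odd (card (sdrs (verts R - Q) (incident R) F)) \<longleftrightarrow> rooted_forest R Q F"
  using assms(2,3)
proof (induction "card (verts R - Q)" arbitrary: Q F rule: less_induct)
  case less
  have fin: "finite (verts R)" "finite F"
    using R less.prems finite_subset by (auto simp: finite_mgraph_def)
  have ends: "ends R e \<subseteq> verts R" if "e \<in> F" for e
    using R that less.prems by (auto simp: finite_mgraph_def)
  show ?case
  proof (cases "\<exists>e\<in>F. \<exists>u\<in>verts R - Q. \<exists>z\<in>Q. ends R e = {u, z}")
    case True
    then obtain e u z where e: "e \<in> F" "u \<in> verts R - Q" "z \<in> Q" "ends R e = {u, z}" by blast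
    have "u \<noteq> z" using e by blast
    have "card (sdrs (verts R - Q) (incident R) F) =
        card (sdrs (verts R - Q - {u}) (incident R) (F - {e}))"
      by (rule card_sdrs_forced) (use e \<open>u \<noteq> z\<close> in \<open>auto simp: incident_def\<close>)
    also have "verts R - Q - {u} = verts R - insert u Q" by blast
    also have "odd (card (sdrs (verts R - insert u Q) (incident R) (F - {e}))) \<longleftrightarrow>
        rooted_forest R (insert u Q) (F - {e})"
    proof (rule less.hyps)
      have "verts R - insert u Q \<subset> verts R - Q" using e by blast
      then show "card (verts R - insert u Q) < card (verts R - Q)"
        using fin by (intro psubset_card_mono) auto
    qed (use e less.prems in auto)
    also have "\<dots> \<longleftrightarrow> rooted_forest R Q (insert e (F - {e}))"
      by (rule rooted_forest_insert[symmetric]) (use e less.prems in auto)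
    finally show ?thesis using e by (simp add: insert_absorb)
  next
    case False
    show ?thesis
    proof (cases "Q = verts R")
      case True
      then show ?thesis
        using rooted_forest_all_roots[OF R less.prems(1)] by (simp add: card_sdrs_empty)
    next
      case neq: False
      then obtain x where x: "x \<in> verts R - Q" using less.prems by blast
      \<comment> \<open>No edge joins a root to a non-root, so the component of \<open>x\<close>
        contains no root.\<close>
      have "y \<in> verts R - Q" if "(x, y) \<in> reach R F" for y
        using that x
      proof (rule reach_closed)
        fix e a b assume "e \<in> F" "ends R e = {a, b}" "a \<in> verts R - Q"
        then show "b \<in> verts R - Q" using False ends[of e] by blast
      qed
      then have "\<not> rooted_forest R Q F" using x unfolding rooted_forest_def by blast
      moreover have "even (card (sdrs (verts R - Q) (incident R) F))"
      proof (rule even_card_sdrs[where X = "verts R - Q"])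
        fix e assume e: "e \<in> F"
        show "even (card {x \<in> verts R - Q. e \<in> incident R x})"
        proof (cases "card (ends R e) = 2")
          case True
          then obtain a b where ab: "ends R e = {a, b}" "a \<noteq> b" by (auto simp: card_2_iff)
          have "a \<in> Q \<longleftrightarrow> b \<in> Q" using False e ab ends[OF e] by (metis DiffI insert_commute insert_subset)
          then have "{x \<in> verts R - Q. e \<in> incident R x} = (if a \<in> Q then {} else {a, b})"
            using ab ends[OF e] by (auto simp: incident_def)
          then show ?thesis using ab by simp
        qed (simp add: incident_def)
      qed (use fin x in auto)
      ultimately show ?thesis by simp
    qed
  qed
qed

subsection \<open>Partitions into a spanning tree and a spanning 2-forest\<close>

lemma component_of_spanning_subgraph:
  "component_of (spanning_subgraph R F) x = {y \<in> verts R. (x, y) \<in> reach R F}"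
  by (simp add: component_of_def reach_def) (simp add: spanning_subgraph_def)

lemma components_spanning_subgraph:
  "components (spanning_subgraph R F) = component_of (spanning_subgraph R F) ` verts R"
  unfolding components_def by (simp add: spanning_subgraph_def)

lemma component_of_eq_iff:
  "x \<in> verts R \<Longrightarrow> y \<in> verts R \<Longrightarrow>
    component_of (spanning_subgraph R F) x = component_of (spanning_subgraph R F) y \<longleftrightarrow> (x, y) \<in> reach R F"
  unfolding component_of_spanning_subgraph using reach_refl reach_sym reach_trans
  by (smt (verit, best) Collect_cong mem_Collect_eq)

lemma Union_components: "\<Union> (components (spanning_subgraph R F)) = verts R"
  by (auto simp: components_spanning_subgraph component_of_spanning_subgraph)

lemma components_disjoint:
  assumes "T \<in> components (spanning_subgraph R F)" "T' \<in> components (spanning_subgraph R F)" "x \<in> T" "x \<in> T'"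
  shows "T = T'"
proof -
  obtain a b where ab: "a \<in> verts R" "T = component_of (spanning_subgraph R F) a"
    "b \<in> verts R" "T' = component_of (spanning_subgraph R F) b"
    using assms by (auto simp: components_spanning_subgraph)
  then have "(a, x) \<in> reach R F" "(b, x) \<in> reach R F"
    using assms by (simp_all add: component_of_spanning_subgraph)
  then show ?thesis using ab component_of_eq_iff reach_sym reach_trans by metis
qed

lemma components_nonempty: "T \<in> components (spanning_subgraph R F) \<Longrightarrow> T \<noteq> {}"
  by (auto simp: components_spanning_subgraph component_of_spanning_subgraph)

lemma two_components:
  assumes "card (components (spanning_subgraph R F)) = 2" "T \<in> components (spanning_subgraph R F)"
  shows "components (spanning_subgraph R F) = {T, verts R - T}" "T \<subseteq> verts R" "T \<noteq> verts R"
proof -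
  obtain T' where T': "components (spanning_subgraph R F) = {T, T'}" "T \<noteq> T'"
    using assms unfolding card_2_iff by (metis empty_iff insert_commute insert_iff)
  have "T \<union> T' = verts R" using Union_components[of R F] T' by simp
  moreover have "T \<inter> T' = {}" using components_disjoint[of T R F T'] T' by blast
  ultimately show "components (spanning_subgraph R F) = {T, verts R - T}" "T \<subseteq> verts R" "T \<noteq> verts R"
    using T' components_nonempty[of T' R F] by (auto simp: Un_Diff)
qed

text \<open>Any vertex can be the root of a spanning tree, so \<open>r\<close> is arbitrary; later
  it is chosen to match a root of the 2-forest.\<close>

lemma spanning_tree_iff_odd_sdrs:
  assumes "finite_mgraph R" "r \<in> verts R" "F \<subseteq> edges R"
  shows "spanning_tree R F \<longleftrightarrow> odd (card (sdrs (verts R - {r}) (incident R) F))"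
proof -
  have "connected_mgraph (spanning_subgraph R F) \<longleftrightarrow> (\<forall>x\<in>verts R. \<forall>y\<in>verts R. (x, y) \<in> reach R F)"
    using assms by (auto simp: connected_mgraph_def reach_def) (auto simp: spanning_subgraph_def)
  also have "\<dots> \<longleftrightarrow> (\<forall>x\<in>verts R. (x, r) \<in> reach R F)"
    using assms(2) by (meson reach_sym reach_trans)
  finally have "spanning_tree R F \<longleftrightarrow> rooted_forest R {r} F"
    using assms by (auto simp: spanning_tree_def tree_def rooted_forest_def)
  then show ?thesis using odd_card_sdrs_incident_iff[of R F "{r}"] assms by simp
qed

text \<open>Two vertices serve as roots of a 2-forest exactly if they lie in different components,
  whence the separation condition.\<close>

lemma spanning_2_forest_iff_odd_sdrs:
  assumes R: "finite_mgraph R" and xy: "x \<in> verts R" "y \<in> verts R" "x \<noteq> y" and F: "F \<subseteq> edges R"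
  shows "spanning_2_forest R F \<and> (x, y) \<notin> reach R F \<longleftrightarrow>
    odd (card (sdrs (verts R - {x, y}) (incident R) F))"
proof -
  let ?C = "component_of (spanning_subgraph R F)"
  have C_eq: "?C a = ?C b \<longleftrightarrow> (a, b) \<in> reach R F" if "a \<in> verts R" "b \<in> verts R" for a b
    using component_of_eq_iff that .
  have "card (components (spanning_subgraph R F)) = 2 \<and> (x, y) \<notin> reach R F \<longleftrightarrow>
      (\<forall>u\<in>verts R. \<exists>!q. q \<in> {x, y} \<and> (u, q) \<in> reach R F)" (is "?l \<longleftrightarrow> ?r")
  proof
    assume l: ?l
    have "{?C x, ?C y} \<subseteq> components (spanning_subgraph R F)"
      using xy by (simp add: components_spanning_subgraph)
    moreover have "card {?C x, ?C y} = 2" using l xy C_eq by simp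
    ultimately have "components (spanning_subgraph R F) = {?C x, ?C y}"
      using l by (metis card.infinite card_subset_eq zero_neq_numeral)
    then have "?C u = ?C x \<or> ?C u = ?C y" if "u \<in> verts R" for u
      using that by (auto simp: components_spanning_subgraph)
    then have "(u, x) \<in> reach R F \<or> (u, y) \<in> reach R F" if "u \<in> verts R" for u
      using that C_eq xy by blast
    then show ?r using l by (blast intro: reach_trans reach_sym)
  next
    assume r: ?r
    have nxy: "(x, y) \<notin> reach R F" using r xy reach_refl[of x R F] by blast
    have "?C u \<in> {?C x, ?C y}" if "u \<in> verts R" for u
      using r that C_eq xy by blast
    then have "components (spanning_subgraph R F) = {?C x, ?C y}"
      using xy by (auto simp: components_spanning_subgraph)
    then show ?l using nxy C_eq xy by simp
  qed
  then have "spanning_2_forest R F \<and> (x, y) \<notin> reach R F \<longleftrightarrow> rooted_forest R {x, y} F"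
    using F unfolding spanning_2_forest_def rooted_forest_def by blast
  then show ?thesis using odd_card_sdrs_incident_iff[of R F "{x, y}"] R xy F by simp
qed

definition tree_2_forests :: "('v, 'e) mgraph \<Rightarrow> ('e set \<times> 'e set) set" where
  "tree_2_forests R = {(\<psi>, \<phi>). \<psi> \<union> \<phi> = edges R \<and> \<psi> \<inter> \<phi> = {} \<and> spanning_tree R \<psi> \<and> spanning_2_forest R \<phi>}"

lemma finite_tree_2_forests: "finite_mgraph R \<Longrightarrow> finite (tree_2_forests R)"
  by (rule finite_subset[of _ "Pow (edges R) \<times> Pow (edges R)"])
    (auto simp: tree_2_forests_def finite_mgraph_def)

text \<open>For \<open>x \<noteq> y\<close>, both factors have a row for \<open>u\<close>, and these two rows coincide.\<close>

lemma even_card_tree_2_forests_separating: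
  assumes R: "finite_mgraph R" and xy: "x \<in> verts R" "y \<in> verts R" and u: "u \<in> verts R" "u \<noteq> x" "u \<noteq> y"
  shows "even (card {(\<psi>, \<phi>) \<in> tree_2_forests R. (x, y) \<notin> reach R \<phi>})"
proof (cases "x = y")
  case False
  let ?I = "verts R - {x}" and ?J = "verts R - {x, y}"
  have iff: "(spanning_tree R \<psi> \<and> spanning_2_forest R \<phi> \<and> (x, y) \<notin> reach R \<phi>) \<longleftrightarrow>
      odd (card (sdrs ?I (incident R) \<psi>)) \<and> odd (card (sdrs ?J (incident R) \<phi>))"
    if "\<psi> \<union> \<phi> = edges R" for \<psi> \<phi>
    using that spanning_tree_iff_odd_sdrs[OF R xy(1), of \<psi>]
      spanning_2_forest_iff_odd_sdrs[OF R xy False, of \<phi>] by blast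
  have "{(\<psi>, \<phi>) \<in> tree_2_forests R. (x, y) \<notin> reach R \<phi>} =
      {(\<psi>, \<phi>). \<psi> \<union> \<phi> = edges R \<and> \<psi> \<inter> \<phi> = {} \<and>
        odd (card (sdrs ?I (incident R) \<psi>)) \<and> odd (card (sdrs ?J (incident R) \<phi>))}"
    unfolding tree_2_forests_def using iff by (simp add: set_eq_iff) blast
  moreover have "even (card \<dots>)"
  proof (rule even_card_partitions_into_odd_sdrs[where X = "{Inl u, Inr u}"])
    fix e
    have "{z \<in> {Inl u, Inr u}. e \<in> case_sum (incident R) (incident R) z} =
        (if e \<in> incident R u then {Inl u, Inr u} else {})"
      by auto
    then show "even (card {z \<in> {Inl u, Inr u}. e \<in> case_sum (incident R) (incident R) z})" by simp
  qed (use R u in \<open>auto simp: finite_mgraph_def\<close>)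
  ultimately show ?thesis by simp
qed simp

text \<open>Fix \<open>r\<close> and sum, over \<open>y\<close> in \<open>Y\<close>, the even number
  of pairs separating \<open>r\<close> from \<open>y\<close>. Counted by pairs, this adds up the
  sizes of the parts of \<open>Y\<close> away from \<open>r\<close>, so an even number of these
  sizes are odd.\<close>

lemma even_card_tree_2_forests_odd_split:
  assumes R: "finite_mgraph R" and Y: "Y \<subseteq> verts R" "even (card Y)" and V: "card (verts R) \<ge> 3"
  shows "even (card {(\<psi>, \<phi>) \<in> tree_2_forests R.
    \<exists>T\<in>components (spanning_subgraph R \<phi>). odd (card (T \<inter> Y))})"
proof -
  have finV: "finite (verts R)" using R by (simp add: finite_mgraph_def)
  then have finY: "finite Y" using Y finite_subset by blast
  have "verts R \<noteq> {}" using V by auto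
  then obtain r where r: "r \<in> verts R" by blast
  let ?f = "\<lambda>(\<psi>, \<phi>). card {y \<in> Y. (r, y) \<notin> reach R \<phi>}"
  have odd_iff: "(\<exists>T\<in>components (spanning_subgraph R \<phi>). odd (card (T \<inter> Y))) \<longleftrightarrow>
      odd (card {y \<in> Y. (r, y) \<notin> reach R \<phi>})" if "spanning_2_forest R \<phi>" for \<phi>
  proof -
    let ?T = "component_of (spanning_subgraph R \<phi>) r"
    have "?T \<in> components (spanning_subgraph R \<phi>)"
      using r by (simp add: components_spanning_subgraph)
    then have comps: "components (spanning_subgraph R \<phi>) = {?T, verts R - ?T}"
      using two_components that by (metis spanning_2_forest_def)
    have "card (?T \<inter> Y) + card ((verts R - ?T) \<inter> Y) = card ((?T \<inter> Y) \<union> ((verts R - ?T) \<inter> Y))"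
      using finY by (subst card_Un_disjoint) auto
    also have "(?T \<inter> Y) \<union> ((verts R - ?T) \<inter> Y) = Y"
      using Y by (auto simp: component_of_spanning_subgraph)
    \<comment> \<open>As \<open>card Y\<close> is even, both parts have the same parity, and the one
      away from \<open>r\<close> decides.\<close>
    finally have "odd (card (?T \<inter> Y)) \<longleftrightarrow> odd (card ((verts R - ?T) \<inter> Y))"
      using Y(2) by presburger
    moreover have "(verts R - ?T) \<inter> Y = {y \<in> Y. (r, y) \<notin> reach R \<phi>}"
      using Y by (auto simp: component_of_spanning_subgraph)
    ultimately show ?thesis using comps by simp
  qed
  have "(\<Sum>p\<in>tree_2_forests R. ?f p) = (\<Sum>y\<in>Y. card {p \<in> tree_2_forests R. (r, y) \<notin> reach R (snd p)})"
    unfolding case_prod_beta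
    by (rule sum_multicount_gen) (use finY finite_tree_2_forests[OF R] in auto)
  also have "even \<dots>"
  proof (rule dvd_sum)
    fix y assume y: "y \<in> Y"
    have "\<not> verts R \<subseteq> {r, y}"
    proof
      assume "verts R \<subseteq> {r, y}"
      then have "card (verts R) \<le> card {r, y}" by (simp add: card_mono)
      then show False using V by (simp add: card_insert_if split: if_splits)
    qed
    then obtain u where "u \<in> verts R" "u \<noteq> r" "u \<noteq> y" by blast
    then have "even (card {(\<psi>, \<phi>) \<in> tree_2_forests R. (r, y) \<notin> reach R \<phi>})"
      using even_card_tree_2_forests_separating[OF R r, of y u] y Y by blast
    also have "{(\<psi>, \<phi>) \<in> tree_2_forests R. (r, y) \<notin> reach R \<phi>} =
        {p \<in> tree_2_forests R. (r, y) \<notin> reach R (snd p)}" by auto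
    finally show "even (card {p \<in> tree_2_forests R. (r, y) \<notin> reach R (snd p)})" .
  qed
  finally have "even (card {p \<in> tree_2_forests R. odd (?f p)})"
    using finite_tree_2_forests[OF R] by (simp add: even_sum_iff)
  also have "{p \<in> tree_2_forests R. odd (?f p)} = {(\<psi>, \<phi>) \<in> tree_2_forests R.
      \<exists>T\<in>components (spanning_subgraph R \<phi>). odd (card (T \<inter> Y))}"
    using odd_iff by (force simp: tree_2_forests_def)
  finally show ?thesis .
qed

section \<open>Cuts between the components\<close>

definition crossing :: "('v, 'e) mgraph \<Rightarrow> 'v set set \<Rightarrow> 'e set" where
  "crossing R \<T> = {e \<in> edges R. \<forall>T\<in>\<T>. \<not> ends R e \<subseteq> T}"

lemma finite_mgraph_ends:
  assumes "finite_mgraph R" "e \<in> edges R"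
  obtains x y where "ends R e = {x, y}" "x \<in> verts R" "y \<in> verts R"
proof -
  have "ends R e \<subseteq> verts R" "card (ends R e) \<in> {1, 2}"
    using assms by (auto simp: finite_mgraph_def)
  then obtain x y where "ends R e = {x, y}"
    by (metis card_1_singletonE card_2_iff insert_absorb2 insertE singletonD)
  then show thesis using that \<open>ends R e \<subseteq> verts R\<close> by simp
qed

lemma crossing_components_disjoint:
  assumes R: "finite_mgraph R" and F: "F \<subseteq> edges R"
  shows "F \<inter> crossing R (components (spanning_subgraph R F)) = {}"
proof -
  have "e \<notin> crossing R (components (spanning_subgraph R F))" if e: "e \<in> F" for e
  proof -
    obtain x y where xy: "ends R e = {x, y}" "x \<in> verts R" "y \<in> verts R"
      using finite_mgraph_ends[OF R] e F by blast
    then have "ends R e \<subseteq> component_of (spanning_subgraph R F) x"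
      using reach_edge[OF e] by (simp add: component_of_spanning_subgraph)
    then show ?thesis using xy by (auto simp: crossing_def components_spanning_subgraph)
  qed
  then show ?thesis by blast
qed

lemma spanning_tree_reach:
  "spanning_tree R F \<Longrightarrow> x \<in> verts R \<Longrightarrow> y \<in> verts R \<Longrightarrow> (x, y) \<in> reach R F"
  unfolding spanning_tree_def tree_def connected_mgraph_def reach_def
  by (simp add: spanning_subgraph_def)

text \<open>Edges of the cut \<open>C = crossing R \<T>\<close> lie in every \<open>\<psi>\<close>. If some \<open>\<psi>\<close> is larger than \<open>C\<close>, then
  \<open>(V, C)\<close> is disconnected. Let \<open>X\<close> be the set of the vertices that \<open>C\<close> does not connect to
  \<open>t\<^sub>1\<close>. Summing the rows of the vertices in \<open>X\<close> gives the same cut for \<open>\<psi>\<close> as for \<open>\<phi>\<close>.\<close>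

lemma even_card_tree_2_forests_fixed_components:
  assumes R: "finite_mgraph R"
  shows "even (card {(\<psi>, \<phi>) \<in> tree_2_forests R.
    components (spanning_subgraph R \<phi>) = \<T> \<and> \<psi> \<noteq> crossing R \<T>})" (is "even (card ?N)")
proof (cases "?N = {}")
  case False
  let ?C = "crossing R \<T>"
  obtain \<psi>0 \<phi>0 where p0: "\<psi>0 \<union> \<phi>0 = edges R" "\<psi>0 \<inter> \<phi>0 = {}" "spanning_tree R \<psi>0" "spanning_2_forest R \<phi>0"
    "components (spanning_subgraph R \<phi>0) = \<T>" "\<psi>0 \<noteq> ?C"
    using False by (auto simp: tree_2_forests_def)
  have "?C \<inter> \<phi>0 = {}" using crossing_components_disjoint[OF R, of \<phi>0] p0 by blast
  then have C0: "?C \<subseteq> \<psi>0" using p0(1) by (auto simp: crossing_def)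
  have card2: "card \<T> = 2" using p0(4,5) by (simp add: spanning_2_forest_def)
  then obtain T where T: "T \<in> \<T>" by fastforce
  then have \<T>: "\<T> = {T, verts R - T}" and TV: "T \<subseteq> verts R" "T \<noteq> verts R"
    using two_components[of R \<phi>0 T] p0(5) card2 by simp_all
  have "T \<noteq> {}" using components_nonempty T p0(5) by metis
  then obtain x y where xy: "x \<in> T" "y \<in> verts R - T" using TV by blast
  \<comment> \<open>The tree \<open>\<psi>0\<close> connects both sides, so it has an edge across
    the cut; its ends become the roots.\<close>
  have "\<exists>e\<in>\<psi>0. \<exists>a b. ends R e = {a, b} \<and> a \<in> T \<and> b \<notin> T"
  proof (rule ccontr)
    assume "\<not> ?thesis"
    then have "y \<in> T" using reach_closed[of x y R \<psi>0 T] spanning_tree_reach[OF p0(3)] xy TV by blast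
    then show False using xy by blast
  qed
  then obtain e t1 t2 where e: "e \<in> \<psi>0" "ends R e = {t1, t2}" and t1: "t1 \<in> T" and "t2 \<notin> T" by blast
  have eR: "e \<in> edges R" using e p0(1) by blast
  then have t2: "t2 \<in> verts R - T"
    using R e(2) \<open>t2 \<notin> T\<close> by (auto simp: finite_mgraph_def)
  have "e \<in> ?C" using eR e(2) t1 t2 by (auto simp: crossing_def \<T>)
  then have t12: "(t1, t2) \<in> reach R ?C" using e(2) by (rule reach_edge)
  have t1V: "t1 \<in> verts R" and t2V: "t2 \<in> verts R" and neq: "t1 \<noteq> t2" using t1 t2 TV by auto
  define X where "X = {x \<in> verts R. (t1, x) \<notin> reach R ?C}"
  have X_sub: "X \<subseteq> verts R - {t1, t2}" using t12 by (auto simp: X_def)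
  have "X \<noteq> {}"
  \<comment> \<open>Otherwise \<open>?C\<close> already connects all vertices, and a further edge of
    \<open>\<psi>0\<close> would close a cycle.\<close>
  proof
    assume empty: "X = {}"
    obtain f where f: "f \<in> \<psi>0" "f \<notin> ?C" using C0 p0(6) by blast
    then obtain u z where uz: "ends R f = {u, z}" "u \<in> verts R" "z \<in> verts R"
      using finite_mgraph_ends[OF R, of f] p0(1) by blast
    then have "(u, z) \<in> reach R ?C"
      using empty unfolding X_def by (blast intro: reach_trans reach_sym)
    then have "(u, z) \<in> reach R (\<psi>0 - {f})" using reach_mono[of ?C "\<psi>0 - {f}" R] C0 f by blast
    then have "\<exists>xs es. is_cycle (spanning_subgraph R (insert f (\<psi>0 - {f}))) xs es"
      using uz(1) by (intro reach_imp_cycle) auto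
    then show False using p0(3) f by (auto simp: insert_absorb spanning_tree_def tree_def forest_def)
  qed
  \<comment> \<open>Hence every spanning tree differs from \<open>?C\<close>, and this condition
    needs no encoding of its own.\<close>
  then have not_tree: "\<not> spanning_tree R ?C"
    using spanning_tree_reach[of R ?C t1] t1V by (auto simp: X_def)
  \<comment> \<open>The roots \<open>t1\<close> and \<open>t2\<close> lie on different sides but are
    joined by \<open>?C\<close>, so \<open>X\<close> avoids both and has rows in both blocks.
    Removing \<open>?C\<close> from the rows \<open>?\<tau>\<close> forces \<open>\<phi>\<close> to
    avoid the cut, which makes \<open>\<T>\<close> its family of components.\<close>
  let ?I = "verts R - {t1}" and ?J = "verts R - {t1, t2}" and ?\<tau> = "\<lambda>u. incident R u - ?C"
  have \<phi>_iff: "spanning_2_forest R \<phi> \<and> components (spanning_subgraph R \<phi>) = \<T> \<longleftrightarrow>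
      odd (card (sdrs ?J ?\<tau> \<phi>))" if \<phi>: "\<phi> \<subseteq> edges R" for \<phi>
  proof (cases "\<phi> \<inter> ?C = {}")
    case False
    then have "sdrs ?J ?\<tau> \<phi> = {}" by (auto simp: sdrs_def bij_betw_def)
    moreover have "components (spanning_subgraph R \<phi>) \<noteq> \<T>"
      using crossing_components_disjoint[OF R \<phi>] False by blast
    ultimately show ?thesis by simp
  next
    case True
    have "\<sigma> i \<notin> ?C" if "bij_betw \<sigma> ?J \<phi>" "i \<in> ?J" for \<sigma> i
      using that True by (auto simp: bij_betw_def)
    then have "sdrs ?J ?\<tau> \<phi> = sdrs ?J (incident R) \<phi>"
      unfolding sdrs_def by blast
    then have "odd (card (sdrs ?J ?\<tau> \<phi>)) \<longleftrightarrow> spanning_2_forest R \<phi> \<and> (t1, t2) \<notin> reach R \<phi>"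
      using spanning_2_forest_iff_odd_sdrs[OF R t1V t2V neq \<phi>] by simp
    also have "\<dots> \<longleftrightarrow> spanning_2_forest R \<phi> \<and> components (spanning_subgraph R \<phi>) = \<T>"
    proof (intro conj_cong refl iffI)
      assume sp: "spanning_2_forest R \<phi>" and n: "(t1, t2) \<notin> reach R \<phi>"
      let ?K = "component_of (spanning_subgraph R \<phi>)"
      have within: "?K u \<subseteq> S" if "u \<in> S" "S \<in> \<T>" for u S
      proof
        fix v assume "v \<in> ?K u"
        then have "(u, v) \<in> reach R \<phi>" by (simp add: component_of_spanning_subgraph)
        then show "v \<in> S"
        proof (rule reach_closed[OF _ that(1)])
          fix g a b assume g: "g \<in> \<phi>" "ends R g = {a, b}" "a \<in> S"
          then have "g \<notin> ?C" "g \<in> edges R" using True \<phi> by auto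
          then obtain S' where "S' \<in> \<T>" "ends R g \<subseteq> S'" by (auto simp: crossing_def)
          then have "S' = S" using g that(2) unfolding \<T> by auto
          then show "b \<in> S" using g \<open>ends R g \<subseteq> S'\<close> by auto
        qed
      qed
      have "?K t1 \<in> components (spanning_subgraph R \<phi>)"
        using t1V by (simp add: components_spanning_subgraph)
      then have K: "components (spanning_subgraph R \<phi>) = {?K t1, verts R - ?K t1}"
        using two_components sp by (metis spanning_2_forest_def)
      moreover have "?K t2 \<in> components (spanning_subgraph R \<phi>)" "?K t2 \<noteq> ?K t1"
        using t1V t2V n component_of_eq_iff[of t1 R t2] by (auto simp: components_spanning_subgraph)
      ultimately have "?K t2 = verts R - ?K t1" by blast
      moreover have "?K t1 \<subseteq> T" "?K t2 \<subseteq> verts R - T" using within t1 t2 \<T> by auto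
      ultimately have "?K t1 = T" using TV by blast
      then show "components (spanning_subgraph R \<phi>) = \<T>" using K \<T> by simp
    next
      assume c: "components (spanning_subgraph R \<phi>) = \<T>"
      show "(t1, t2) \<notin> reach R \<phi>"
      proof
        let ?S = "component_of (spanning_subgraph R \<phi>) t1"
        assume "(t1, t2) \<in> reach R \<phi>"
        then have "t1 \<in> ?S" "t2 \<in> ?S" using t1V t2V by (simp_all add: component_of_spanning_subgraph)
        moreover have "?S \<in> \<T>" using t1V c by (auto simp: components_spanning_subgraph)
        ultimately show False using t1 t2 unfolding \<T> by auto
      qed
    qed
    finally show ?thesis by blast
  qed
  have iff: "(spanning_tree R \<psi> \<and> spanning_2_forest R \<phi> \<and>
        components (spanning_subgraph R \<phi>) = \<T> \<and> \<psi> \<noteq> ?C) \<longleftrightarrow>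
      odd (card (sdrs ?I (incident R) \<psi>)) \<and> odd (card (sdrs ?J ?\<tau> \<phi>))"
    if "\<psi> \<union> \<phi> = edges R" for \<psi> \<phi>
    using that spanning_tree_iff_odd_sdrs[OF R t1V, of \<psi>] \<phi>_iff[of \<phi>] not_tree by blast
  have "?N = {(\<psi>, \<phi>). \<psi> \<union> \<phi> = edges R \<and> \<psi> \<inter> \<phi> = {} \<and>
      odd (card (sdrs ?I (incident R) \<psi>)) \<and> odd (card (sdrs ?J ?\<tau> \<phi>))}"
    unfolding tree_2_forests_def using iff by (simp add: set_eq_iff) blast
  moreover have "even (card \<dots>)"
  proof (rule even_card_partitions_into_odd_sdrs[where X = "X <+> X"])
    have finX: "finite X" using R by (simp add: X_def finite_mgraph_def)
    fix f assume f: "f \<in> edges R"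
    let ?A = "{x \<in> X. f \<in> incident R x}" and ?B = "{x \<in> X. f \<in> ?\<tau> x}"
    have "{z \<in> X <+> X. f \<in> case_sum (incident R) ?\<tau> z} = ?A <+> ?B" by auto
    then have card: "card {z \<in> X <+> X. f \<in> case_sum (incident R) ?\<tau> z} = card ?A + card ?B"
      using finX by (simp add: card_Plus)
    \<comment> \<open>A cut edge has both ends in \<open>X\<close> or neither, and is absent from
      the second block; any other edge occurs equally often in both blocks.\<close>
    show "even (card {z \<in> X <+> X. f \<in> case_sum (incident R) ?\<tau> z})"
    proof (cases "f \<in> ?C")
      case True
      have "even (card ?A)"
      proof (cases "card (ends R f) = 2")
        case True
        then obtain a b where ab: "ends R f = {a, b}" "a \<noteq> b" by (auto simp: card_2_iff)
        have abV: "a \<in> verts R" "b \<in> verts R" using f R ab by (auto simp: finite_mgraph_def)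
        have "(a, b) \<in> reach R ?C" using \<open>f \<in> ?C\<close> ab(1) by (rule reach_edge)
        then have "a \<in> X \<longleftrightarrow> b \<in> X" using abV by (auto simp: X_def intro: reach_trans reach_sym)
        then have "?A = (if a \<in> X then {a, b} else {})" using ab by (auto simp: incident_def)
        then show ?thesis using ab by simp
      qed (simp add: incident_def)
      then show ?thesis using True card by simp
    next
      case False
      then have "?A = ?B" by simp
      then show ?thesis using card by simp
    qed
  qed (use R X_sub \<open>X \<noteq> {}\<close> in \<open>auto simp: finite_mgraph_def\<close>)
  ultimately show ?thesis by simp
qed (simp only: card.empty, simp)

text \<open>Group the pairs by the components of \<open>\<phi>\<close>. As \<open>P\<close> depends
  only on these, each group is kept entirely or dropped entirely.\<close>

lemma even_card_tree_2_forests_not_crossing: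
  assumes R: "finite_mgraph R"
  shows "even (card {(\<psi>, \<phi>) \<in> tree_2_forests R. P (components (spanning_subgraph R \<phi>)) \<and>
    \<psi> \<noteq> crossing R (components (spanning_subgraph R \<phi>))})" (is "even (card ?N)")
proof -
  let ?c = "\<lambda>p. components (spanning_subgraph R (snd p))"
  have fin: "finite ?N"
    by (rule finite_subset[OF _ finite_tree_2_forests[OF R]]) auto
  have "even (card {p \<in> ?N. ?c p = \<T>})" for \<T>
  proof -
    have "{p \<in> ?N. ?c p = \<T>} = (if P \<T> then {(\<psi>, \<phi>) \<in> tree_2_forests R.
        components (spanning_subgraph R \<phi>) = \<T> \<and> \<psi> \<noteq> crossing R \<T>} else {})"
      by auto
    then show ?thesis
      using even_card_tree_2_forests_fixed_components[OF R, of \<T>] by simp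
  qed
  then have "even (\<Sum>\<T>\<in>?c ` ?N. card {p \<in> ?N. ?c p = \<T>})" by (intro dvd_sum) blast
  also have "(\<Sum>\<T>\<in>?c ` ?N. card {p \<in> ?N. ?c p = \<T>}) = card ?N"
    using sum.image_gen[OF fin, of "\<lambda>_. 1 :: nat" ?c] by simp
  finally show ?thesis .
qed

text \<open>Each of the n - 1 edges of the tree \<open>\<psi>\<close> has one end in
  \<open>T\<close>, where n = \<open>card (verts R)\<close>, and each of the |T| - 1 edges of
  \<open>\<phi>\<close> inside \<open>T\<close> has two. The summand 3 avoids subtraction.\<close>

lemma sum_degrees_crossing:
  assumes R: "finite_mgraph R" and p: "(\<psi>, \<phi>) \<in> tree_2_forests R"
    and cross: "\<psi> = crossing R (components (spanning_subgraph R \<phi>))"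
    and T: "T \<in> components (spanning_subgraph R \<phi>)"
  shows "(\<Sum>u\<in>T. card {e \<in> edges R. u \<in> ends R e}) + 3 = 2 * card T + card (verts R)"
proof -
  have part: "\<psi> \<union> \<phi> = edges R" "\<psi> \<inter> \<phi> = {}" and tree: "spanning_tree R \<psi>" and forest: "spanning_2_forest R \<phi>"
    using p by (auto simp: tree_2_forests_def)
  have finE: "finite (edges R)" and finV: "finite (verts R)" using R by (auto simp: finite_mgraph_def)
  have comps: "components (spanning_subgraph R \<phi>) = {T, verts R - T}" and TV: "T \<subseteq> verts R" "T \<noteq> verts R"
    using two_components[OF _ T] forest by (auto simp: spanning_2_forest_def)
  have finT: "finite T" using finV TV finite_subset by blast
  obtain t where t: "t \<in> T" using components_nonempty[OF T] by blast
  obtain t' where t': "t' \<in> verts R - T" using TV by blast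
  have tV: "t \<in> verts R" "t' \<in> verts R" "t \<noteq> t'" using t t' TV by auto
  \<comment> \<open>An odd number is nonzero, so representatives exist; they count the edges, one
    for each non-root.\<close>
  obtain \<sigma> where \<sigma>: "bij_betw \<sigma> (verts R - {t}) \<psi>"
    and \<sigma>_mem: "\<And>i. i \<in> verts R - {t} \<Longrightarrow> \<sigma> i \<in> incident R i"
  proof -
    have "card (sdrs (verts R - {t}) (incident R) \<psi>) \<noteq> 0"
      using spanning_tree_iff_odd_sdrs[OF R tV(1), of \<psi>] tree part by (metis Un_upper1 even_zero)
    then obtain \<sigma> where "\<sigma> \<in> sdrs (verts R - {t}) (incident R) \<psi>" by fastforce
    then show thesis using that unfolding sdrs_def by blast
  qed
  have inside: "ends R e \<subseteq> T \<or> ends R e \<subseteq> verts R - T" if "e \<in> \<phi>" for e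
    using that part cross comps by (auto simp: crossing_def)
  have "(t, t') \<notin> reach R \<phi>"
  proof
    assume "(t, t') \<in> reach R \<phi>"
    then have "t' \<in> T"
    proof (rule reach_closed[OF _ t])
      fix e a b assume "e \<in> \<phi>" "ends R e = {a, b}" "a \<in> T"
      then show "b \<in> T" using inside[of e] by auto
    qed
    then show False using t' by blast
  qed
  then obtain \<tau> where \<tau>: "bij_betw \<tau> (verts R - {t, t'}) \<phi>"
    and \<tau>_mem: "\<And>i. i \<in> verts R - {t, t'} \<Longrightarrow> \<tau> i \<in> incident R i"
  proof -
    have "card (sdrs (verts R - {t, t'}) (incident R) \<phi>) \<noteq> 0"
      using spanning_2_forest_iff_odd_sdrs[OF R tV, of \<phi>] forest \<open>(t, t') \<notin> reach R \<phi>\<close> part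
      by (metis Un_upper2 even_zero)
    then obtain \<tau> where "\<tau> \<in> sdrs (verts R - {t, t'}) (incident R) \<phi>" by fastforce
    then show thesis using that unfolding sdrs_def by blast
  qed
  have nonloop: "card (ends R e) = 2" if "e \<in> edges R" for e
  proof -
    have "e \<in> \<sigma> ` (verts R - {t}) \<or> e \<in> \<tau> ` (verts R - {t, t'})"
      using that part(1) \<sigma> \<tau> by (auto simp: bij_betw_def)
    then show ?thesis using \<sigma>_mem \<tau>_mem by (auto simp: incident_def)
  qed
  have card_\<psi>: "card \<psi> = card (verts R) - 1"
    using bij_betw_same_card[OF \<sigma>] tV finV by simp
  \<comment> \<open>Edges of \<open>\<phi>\<close> stay on one side, so the bijection restricts to
    \<open>T\<close>, where only the root \<open>t\<close> is left out.\<close>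
  have "bij_betw \<tau> (T - {t}) {e \<in> \<phi>. ends R e \<subseteq> T}"
  proof (rule bij_betw_subset[OF \<tau>])
    show "T - {t} \<subseteq> verts R - {t, t'}" using TV t' by blast
    have mem: "i \<in> ends R (\<tau> i)" if "i \<in> verts R - {t, t'}" for i
      using \<tau>_mem[OF that] by (simp add: incident_def)
    show "\<tau> ` (T - {t}) = {e \<in> \<phi>. ends R e \<subseteq> T}"
    proof (intro equalityI subsetI)
      fix e assume "e \<in> \<tau> ` (T - {t})"
      then obtain i where i: "i \<in> T - {t}" "e = \<tau> i" by blast
      then have "i \<in> verts R - {t, t'}" using TV t' by blast
      then have "e \<in> \<phi>" "i \<in> ends R e" using \<tau> mem i by (auto simp: bij_betw_def)
      then show "e \<in> {e \<in> \<phi>. ends R e \<subseteq> T}" using inside[of e] i by blast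
    next
      fix e assume e: "e \<in> {e \<in> \<phi>. ends R e \<subseteq> T}"
      then obtain i where i: "i \<in> verts R - {t, t'}" "e = \<tau> i" using \<tau> by (auto simp: bij_betw_def)
      then have "i \<in> T" using mem[of i] e by blast
      then show "e \<in> \<tau> ` (T - {t})" using i by blast
    qed
  qed
  then have card_\<phi>: "card {e \<in> \<phi>. ends R e \<subseteq> T} = card T - 1"
    using bij_betw_same_card t finT by fastforce
  have "(\<Sum>u\<in>T. card {e \<in> edges R. u \<in> ends R e}) = (\<Sum>e\<in>edges R. card {u \<in> T. u \<in> ends R e})"
    by (rule sum_multicount_gen) (use finT finE in auto)
  also have "\<dots> = (\<Sum>e\<in>\<psi>. card {u \<in> T. u \<in> ends R e}) + (\<Sum>e\<in>\<phi>. card {u \<in> T. u \<in> ends R e})"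
    unfolding part(1)[symmetric] by (rule sum.union_disjoint) (use finE part in \<open>auto intro: finite_subset\<close>)
  also have "(\<Sum>e\<in>\<psi>. card {u \<in> T. u \<in> ends R e}) = card \<psi>"
  proof -
    have "card {u \<in> T. u \<in> ends R e} = 1" if e: "e \<in> \<psi>" for e
    proof -
      have eR: "e \<in> edges R" using e part by blast
      then obtain a b where ab: "ends R e = {a, b}" "a \<in> verts R" "b \<in> verts R"
        using finite_mgraph_ends[OF R] by blast
      have "\<not> ends R e \<subseteq> T" "\<not> ends R e \<subseteq> verts R - T"
        using e cross comps by (auto simp: crossing_def)
      then have "{u \<in> T. u \<in> ends R e} = {a} \<or> {u \<in> T. u \<in> ends R e} = {b}" using ab by auto
      then show ?thesis by auto
    qed
    then show ?thesis by simp
  qed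
  also have "(\<Sum>e\<in>\<phi>. card {u \<in> T. u \<in> ends R e}) = (\<Sum>e\<in>\<phi>. if ends R e \<subseteq> T then 2 else 0)"
  proof (rule sum.cong[OF refl])
    fix e assume e: "e \<in> \<phi>"
    then have "card (ends R e) = 2" using nonloop part by blast
    moreover have "{u \<in> T. u \<in> ends R e} = (if ends R e \<subseteq> T then ends R e else {})"
      using inside[OF e] by auto
    ultimately show "card {u \<in> T. u \<in> ends R e} = (if ends R e \<subseteq> T then 2 else 0)" by simp
  qed
  also have "\<dots> = 2 * card {e \<in> \<phi>. ends R e \<subseteq> T}"
    using finE part by (subst sum.If_cases) (auto simp: Int_def intro: finite_subset)
  finally have "(\<Sum>u\<in>T. card {e \<in> edges R. u \<in> ends R e}) = card (verts R) - 1 + 2 * (card T - 1)"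
    using card_\<psi> card_\<phi> by simp
  moreover have "card T \<ge> 1" using t finT by (metis Suc_leI card_gt_0_iff empty_iff One_nat_def)
  moreover have "card T \<le> card (verts R)" using TV finV by (simp add: card_mono)
  ultimately show ?thesis by simp
qed

subsection \<open>Deleting two adjacent vertices of a 4-regular graph\<close>

text \<open>Sending an edge at \<open>w\<close> to its other end hits every neighbour. There are at
  most as many such edges as neighbours, so this map is injective.\<close>

lemma unique_edge_to_neighbour:
  assumes G: "finite_mgraph G" and deg: "degree G w \<le> card (neighbours G w)" and w: "w \<notin> neighbours G w"
    and e: "e \<in> edges G" "ends G e = {x, w}" and e': "e' \<in> edges G" "ends G e' = {x, w}"
  shows "e = e'"
proof -
  let ?E = "{e \<in> edges G. w \<in> ends G e}" and ?f = "\<lambda>e. the_elem (ends G e - {w})"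
  have finE: "finite ?E" using G by (simp add: finite_mgraph_def)
  have "neighbours G w \<subseteq> ?f ` ?E"
  proof
    fix y assume y: "y \<in> neighbours G w"
    then obtain g where g: "g \<in> edges G" "ends G g = {w, y}"
      by (auto simp: neighbours_def adj_rel_def)
    have "y \<noteq> w" using y w by blast
    then have "ends G g - {w} = {y}" using g by auto
    then have "?f g = y" by simp
    then show "y \<in> ?f ` ?E" using g by blast
  qed
  then have "card (neighbours G w) \<le> card (?f ` ?E)" using finE by (simp add: card_mono)
  moreover have "card (?f ` ?E) \<le> card ?E" using finE by (rule card_image_le)
  moreover have "card ?E \<le> degree G w" by (simp add: degree_def)
  ultimately have "card (?f ` ?E) = card ?E" using deg by linarith
  then have "inj_on ?f ?E" using finE by (simp add: eq_card_imp_inj_on)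
  then show ?thesis
    by (rule inj_onD) (use e e' in simp_all)
qed

text \<open>The two components partition the vertices, so if one meets \<open>S\<close> in
  \<open>x\<close> alone, the other contains the rest of \<open>S\<close>.\<close>

lemma compatible_singleton_iff:
  assumes "spanning_2_forest R F" "S \<subseteq> verts R" "x \<in> S"
  shows "compatible R {x} (S - {x}) F \<longleftrightarrow> (\<exists>T\<in>components (spanning_subgraph R F). T \<inter> S = {x})"
proof
  assume "compatible R {x} (S - {x}) F"
  then obtain T1 T2 where T: "components (spanning_subgraph R F) = {T1, T2}"
    "x \<in> T1" "(S - {x}) \<inter> T1 = {}"
    by (auto simp: compatible_def)
  then have "T1 \<inter> S = {x}" using assms(3) by blast
  then show "\<exists>T\<in>components (spanning_subgraph R F). T \<inter> S = {x}" using T by blast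
next
  assume "\<exists>T\<in>components (spanning_subgraph R F). T \<inter> S = {x}"
  then obtain T where T: "T \<in> components (spanning_subgraph R F)" "T \<inter> S = {x}" by blast
  then have "components (spanning_subgraph R F) = {T, verts R - T}"
    using two_components assms(1) by (metis spanning_2_forest_def)
  then show "compatible R {x} (S - {x}) F"
    unfolding compatible_def using T(2) assms(2) by (intro exI[of _ T] exI[of _ "verts R - T"]) auto
qed

lemma tree_forest_pairs_singleton:
  assumes "S \<subseteq> verts R" "x \<in> S"
  shows "tree_forest_pairs R {x} (S - {x}) =
    {(\<psi>, \<phi>) \<in> tree_2_forests R. \<exists>T\<in>components (spanning_subgraph R \<phi>). T \<inter> S = {x}}"
  using compatible_singleton_iff[OF _ assms]
  by (auto simp: tree_forest_pairs_def tree_2_forests_def)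

text \<open>If \<open>\<psi>\<close> is the whole cut, the degree sum of \<open>T\<close> gives \<open>2 |T| + 3 = n + |T \<inter> S|\<close> where \<open>n = |V|\<close>.
  So \<open>n\<close> is even whenever \<open>|T \<inter> S|\<close> is odd, and then \<open>|T| mod 2\<close> distinguishes the splits of type
  1|5 from those of type 3|3; the set \<open>Y\<close> below expresses this by one parity.\<close>

lemma even_card_tree_2_forests_one_five_split:
  assumes R: "finite_mgraph R" and S: "S \<subseteq> verts R" "card S = 6"
    and deg: "\<And>u. u \<in> verts R \<Longrightarrow> degree R u = (if u \<in> S then 3 else 4)"
  shows "even (card {(\<psi>, \<phi>) \<in> tree_2_forests R.
    \<exists>T\<in>components (spanning_subgraph R \<phi>). card (T \<inter> S) = 1})" (is "even (card ?U)")
proof -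
  let ?n = "card (verts R)" and ?comps = "\<lambda>\<phi>. components (spanning_subgraph R \<phi>)"
  have finV: "finite (verts R)" using R by (simp add: finite_mgraph_def)
  have finS: "finite S" using S finV finite_subset by blast
  have n6: "?n \<ge> 6" using S finV card_mono by metis
  have size: "2 * card T + 3 = ?n + card (T \<inter> S)"
    if p: "(\<psi>, \<phi>) \<in> tree_2_forests R" "\<psi> = crossing R (?comps \<phi>)" and T: "T \<in> ?comps \<phi>" for \<psi> \<phi> T
  proof -
    have TV: "T \<subseteq> verts R" using Union_components[of R \<phi>] T by blast
    then have finT: "finite T" using finV finite_subset by blast
    \<comment> \<open>Each edge lies in one of two forests, so \<open>degree\<close> is a plain
      count of edges.\<close>
    have no_loop: "ends R e \<noteq> {u}" if "e \<in> edges R" for e u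
    proof
      assume "ends R e = {u}"
      then have loop: "ends R e = {u, u}" by simp
      have "e \<in> \<psi> \<or> e \<in> \<phi>" using that p by (auto simp: tree_2_forests_def)
      moreover have "\<not> forest (spanning_subgraph R F)" if "e \<in> F" for F
        using reach_imp_cycle[OF reach_refl, of e "F - {e}" R u] loop that
        by (auto simp: insert_absorb forest_def)
      ultimately show False
        using p by (auto simp: tree_2_forests_def spanning_tree_def tree_def spanning_2_forest_def)
    qed
    have "card {e \<in> edges R. u \<in> ends R e} = degree R u" for u
    proof -
      have "{e \<in> edges R. ends R e = {u}} = {}" using no_loop by blast
      then show ?thesis by (simp only: degree_def card.empty add_0_right)
    qed
    \<comment> \<open>Adding 1 at each vertex of \<open>S\<close> turns every degree in
      \<open>T\<close> into 4.\<close>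
    then have "(\<Sum>u\<in>T. card {e \<in> edges R. u \<in> ends R e}) + (\<Sum>u\<in>T. if u \<in> S then 1 else 0) =
        (\<Sum>u\<in>T. degree R u + (if u \<in> S then 1 else 0))"
      by (simp add: sum.distrib)
    also have "\<dots> = (\<Sum>u\<in>T. 4)"
      by (rule sum.cong) (use deg TV in auto)
    also have "(\<Sum>u\<in>T. if u \<in> S then 1 else 0) = card (T \<inter> S)"
      using finT by (simp add: sum.If_cases)
    finally show ?thesis using sum_degrees_crossing[OF R p T] by simp
  qed
  have complement: "\<exists>T'\<in>?comps \<phi>. card (T \<inter> S) + card (T' \<inter> S) = 6"
    if "spanning_2_forest R \<phi>" "T \<in> ?comps \<phi>" for \<phi> T
  proof -
    have c: "?comps \<phi> = {T, verts R - T}"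
      using two_components that by (metis spanning_2_forest_def)
    have "card (T \<inter> S) + card ((verts R - T) \<inter> S) = card ((T \<inter> S) \<union> ((verts R - T) \<inter> S))"
      using finS by (subst card_Un_disjoint) auto
    also have "(T \<inter> S) \<union> ((verts R - T) \<inter> S) = S" using S by blast
    finally show ?thesis using c S by auto
  qed
  \<comment> \<open>For even n, \<open>size\<close> gives |T| = n/2 - 1, n/2, n/2 + 1 if
    \<open>T\<close> has 1, 3, 5 vertices in \<open>S\<close>, and excludes even numbers. If 4
    divides n, these sizes are odd, even, odd; otherwise discarding the vertices of \<open>S\<close>
    produces this pattern.\<close>
  let ?Y = "if 4 dvd ?n then verts R else verts R - S"
  let ?W = "{(\<psi>, \<phi>) \<in> tree_2_forests R. \<exists>T\<in>?comps \<phi>. odd (card (T \<inter> ?Y))}"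
  let ?cross = "{(\<psi>, \<phi>) \<in> tree_2_forests R. \<psi> = crossing R (?comps \<phi>)}"
  have fin: "finite ?U" "finite ?W"
    by (rule finite_subset[OF _ finite_tree_2_forests[OF R]], blast)+
  \<comment> \<open>Pairs outside \<open>?cross\<close> are even in number, so both counts can be
    compared within \<open>?cross\<close>.\<close>
  have split: "even (card A) \<longleftrightarrow> even (card (A \<inter> ?cross))"
    if "even (card (A - ?cross))" "finite A" for A :: "('b set \<times> 'b set) set"
  proof -
    have "card ((A \<inter> ?cross) \<union> (A - ?cross)) = card (A \<inter> ?cross) + card (A - ?cross)"
      by (rule card_Un_disjoint) (use that(2) in \<open>simp_all add: Int_Diff_disjoint\<close>)
    also have "(A \<inter> ?cross) \<union> (A - ?cross) = A" by (rule Int_Diff_Un)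
    finally have "card A = card (A \<inter> ?cross) + card (A - ?cross)" .
    then show ?thesis using that(1) even_add[of "card (A \<inter> ?cross)" "card (A - ?cross)"] by argo
  qed
  have "?U - ?cross = {(\<psi>, \<phi>) \<in> tree_2_forests R. (\<exists>T\<in>?comps \<phi>. card (T \<inter> S) = 1) \<and>
      \<psi> \<noteq> crossing R (?comps \<phi>)}" by blast
  then have U: "even (card ?U) \<longleftrightarrow> even (card (?U \<inter> ?cross))"
    using even_card_tree_2_forests_not_crossing[OF R, of "\<lambda>\<T>. \<exists>T\<in>\<T>. card (T \<inter> S) = 1"] fin
    by (intro split) simp_all
  have "?W - ?cross = {(\<psi>, \<phi>) \<in> tree_2_forests R. (\<exists>T\<in>?comps \<phi>. odd (card (T \<inter> ?Y))) \<and>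
      \<psi> \<noteq> crossing R (?comps \<phi>)}" by blast
  then have W: "even (card ?W) \<longleftrightarrow> even (card (?W \<inter> ?cross))"
    using even_card_tree_2_forests_not_crossing[OF R, of "\<lambda>\<T>. \<exists>T\<in>\<T>. odd (card (T \<inter> ?Y))"] fin
    by (intro split) simp_all
  show ?thesis
  proof (cases "even ?n")
    case False
    \<comment> \<open>One vertex of \<open>S\<close> in \<open>T\<close> would give 2 |T| + 2 = n,
      but n is odd.\<close>
    have "?U \<inter> ?cross = {}"
    proof -
      have "card (T \<inter> S) \<noteq> 1" if "(\<psi>, \<phi>) \<in> tree_2_forests R" "\<psi> = crossing R (?comps \<phi>)" "T \<in> ?comps \<phi>" for \<psi> \<phi> T
        using size[OF that] False by presburger
      then show ?thesis by blast
    qed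
    then show ?thesis using U by simp
  next
    case True
    have "even (card ?Y)"
      using True S finS by (simp add: card_Diff_subset)
    then have "even (card ?W)"
      using even_card_tree_2_forests_odd_split[OF R, of ?Y] n6 by simp
    moreover have "(\<exists>T\<in>?comps \<phi>. card (T \<inter> S) = 1) \<longleftrightarrow> (\<exists>T\<in>?comps \<phi>. odd (card (T \<inter> ?Y)))"
      if p: "(\<psi>, \<phi>) \<in> tree_2_forests R" "\<psi> = crossing R (?comps \<phi>)" for \<psi> \<phi>
    proof -
      have forest: "spanning_2_forest R \<phi>" using p by (simp add: tree_2_forests_def)
      have Y: "card (T \<inter> ?Y) = (if 4 dvd ?n then card T else card T - card (T \<inter> S)) \<and> card (T \<inter> S) \<le> card T"
        if "T \<in> ?comps \<phi>" for T
      proof -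
        have TV: "T \<subseteq> verts R" using Union_components[of R \<phi>] that by blast
        then have "finite T" using finV finite_subset by blast
        moreover have "T \<inter> (verts R - S) = T - T \<inter> S" "T \<inter> verts R = T" using TV by auto
        ultimately show ?thesis by (simp add: card_Diff_subset card_mono)
      qed
      show ?thesis
      proof
        assume "\<exists>T\<in>?comps \<phi>. card (T \<inter> S) = 1"
        then obtain T where T: "T \<in> ?comps \<phi>" "card (T \<inter> S) = 1" by blast
        have "odd (card (T \<inter> ?Y))"
          using Y[OF T(1)] size[OF p T(1)] T(2) True by (simp split: if_splits) presburger+
        then show "\<exists>T\<in>?comps \<phi>. odd (card (T \<inter> ?Y))" using T by blast
      next
        assume "\<exists>T\<in>?comps \<phi>. odd (card (T \<inter> ?Y))"
        then obtain T where T: "T \<in> ?comps \<phi>" "odd (card (T \<inter> ?Y))" by blast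
        \<comment> \<open>\<open>T\<close> may be the part with five vertices of \<open>S\<close>;
          then its complement is the witness.\<close>
        obtain T' where T': "T' \<in> ?comps \<phi>" "card (T \<inter> S) + card (T' \<inter> S) = 6"
          using complement[OF forest T(1)] by blast
        have "odd (card (T \<inter> S))" using size[OF p T(1)] True by presburger
        moreover have "card (T \<inter> S) \<noteq> 3"
          using Y[OF T(1)] size[OF p T(1)] T(2) True by (simp split: if_splits) presburger+
        ultimately have "card (T \<inter> S) = 1 \<or> card (T' \<inter> S) = 1"
          using T'(2) by presburger
        then show "\<exists>T\<in>?comps \<phi>. card (T \<inter> S) = 1" using T T' by blast
      qed
    qed
    then have "?U \<inter> ?cross = ?W \<inter> ?cross" by blast
    ultimately show ?thesis using U W by simp
  qed
qed

text \<open>Deleting \<open>v\<close> and \<open>w\<close> lowers the degrees of exactly the six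
  listed vertices, each by one. The six sets of pairs are disjoint, and their union consists of the
  pairs that split these vertices as 1|5.\<close>

theorem mainTheorem7:
  fixes G R :: "('v, 'e) mgraph" and v w a b c d e f :: 'v
  assumes "finite_mgraph G" and "connected_mgraph G" and "regular 4 G"
    and "v \<in> verts G" and "w \<in> verts G"
    and "w \<in> neighbours G v" and "neighbours G v \<inter> neighbours G w = {}"
    and "neighbours G w = {v, a, b, c}" and "neighbours G v = {w, d, e, f}"
    and "distinct [v, w, a, b, c, d, e, f]"
    and "R = delete_verts G {v, w}"
  shows "(\<exists>\<iota>. fixed_point_free_involution_on
             (tree_forest_pairs R {a} {b, c, d, e, f} \<union> tree_forest_pairs R {b} {a, c, d, e, f} \<union>
              tree_forest_pairs R {c} {a, b, d, e, f} \<union> tree_forest_pairs R {d} {a, b, c, e, f} \<union>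
              tree_forest_pairs R {e} {a, b, c, d, f} \<union> tree_forest_pairs R {f} {a, b, c, d, e}) \<iota>)
       \<and> [card (tree_forest_pairs R {a} {b, c, d, e, f}) + card (tree_forest_pairs R {b} {a, c, d, e, f}) +
          card (tree_forest_pairs R {c} {a, b, d, e, f}) + card (tree_forest_pairs R {d} {a, b, c, e, f}) +
          card (tree_forest_pairs R {e} {a, b, c, d, f}) + card (tree_forest_pairs R {f} {a, b, c, d, e}) = 0] (mod 2)"
proof -
  note G = assms(1) and nw = assms(8) and nv = assms(9) and dist = assms(10) and R_def = assms(11)
  have vR: "verts R = verts G - {v, w}"
    and eR: "edges R = {g \<in> edges G. ends G g \<inter> {v, w} = {}}"
    and ends: "ends R = ends G"
    by (simp_all add: R_def delete_verts_def)
  have R: "finite_mgraph R"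
    using G unfolding finite_mgraph_def vR eR ends by auto
  let ?S = "{a, b, c, d, e, f}"
  have nb: "x \<in> neighbours G y \<longleftrightarrow> (\<exists>g\<in>edges G. ends G g = {x, y})" for x y
    by (auto simp: neighbours_def adj_rel_def insert_commute)
  have "neighbours G y \<subseteq> verts G" for y
  proof
    fix x assume "x \<in> neighbours G y"
    then obtain g where "g \<in> edges G" "ends G g = {x, y}" using nb by blast
    moreover from this have "ends G g \<subseteq> verts G" using G unfolding finite_mgraph_def by blast
    ultimately show "x \<in> verts G" by simp
  qed
  then have S: "?S \<subseteq> verts R" "card ?S = 6"
    using nw nv dist unfolding vR by auto
  \<comment> \<open>Four distinct neighbours exhaust the degree 4, so no parallel edges meet
    \<open>v\<close> or \<open>w\<close>.\<close>
  have uniq: "g = h" if "y \<in> {v, w}" "g \<in> edges G" "ends G g = {x, y}" "h \<in> edges G" "ends G h = {x, y}" for g h x y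
  proof (rule unique_edge_to_neighbour[OF G _ _ that(2-5)])
    have "card (neighbours G y) = 4" "y \<notin> neighbours G y" using that(1) nv nw dist by auto
    then show "degree G y \<le> card (neighbours G y)" "y \<notin> neighbours G y"
      using that(1) assms(3-5) by (auto simp: regular_def)
  qed
  have "degree R u = (if u \<in> ?S then 3 else 4)" if u: "u \<in> verts R" for u
  proof -
    let ?D = "{g \<in> edges G. u \<in> ends G g \<and> ends G g \<inter> {v, w} \<noteq> {}}"
    have uG: "u \<in> verts G" "u \<noteq> v" "u \<noteq> w" using u vR by auto
    have D: "ends G g = {u, v} \<or> ends G g = {u, w}" if "g \<in> ?D" for g
    proof -
      obtain x y where "ends G g = {x, y}" using finite_mgraph_ends[OF G, of g] \<open>g \<in> ?D\<close> by blast
      then show ?thesis using \<open>g \<in> ?D\<close> uG by auto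
    qed
    have finE: "finite (edges G)" using G by (simp add: finite_mgraph_def)
    have "card ?D = (if u \<in> ?S then 1 else 0)"
    proof (cases "u \<in> ?S")
      case True
      then obtain y where y: "y \<in> {v, w}" "u \<in> neighbours G y" using nv nw by auto
      then obtain g where g: "g \<in> edges G" "ends G g = {u, y}" using nb by blast
      \<comment> \<open>Without common neighbours, \<open>u\<close> has no edge to the other deleted
        vertex, and \<open>uniq\<close> excludes a second edge to \<open>y\<close>.\<close>
      have "h = g" if h: "h \<in> ?D" for h
      proof -
        have "u \<in> neighbours G y'" if "ends G h = {u, y'}" for y' using that h nb by blast
        then have "ends G h = {u, y}" using D[OF h] y assms(7) by auto
        then show ?thesis using uniq[OF y(1)] g h by blast
      qed
      then have "?D = {g}" using g y by auto
      then show ?thesis using True by simp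
    next
      case False
      have "u \<notin> neighbours G v" "u \<notin> neighbours G w" using False nv nw uG by auto
      then have none: "g \<notin> ?D" for g
        using D[of g] nb[of u v] nb[of u w] by auto
      have "?D = {}" by (rule equals0I) (rule none[THEN notE])
      then show ?thesis using False by (simp only: card.empty if_False)
    qed
    moreover have "card {g \<in> edges G. u \<in> ends G g} = card {g \<in> edges R. u \<in> ends R g} + card ?D"
    proof -
      have "{g \<in> edges G. u \<in> ends G g} = {g \<in> edges R. u \<in> ends R g} \<union> ?D"
        unfolding eR ends by blast
      moreover have "{g \<in> edges R. u \<in> ends R g} \<inter> ?D = {}" unfolding eR ends by blast
      ultimately show ?thesis using finE by (simp add: card_Un_disjoint eR)
    qed
    moreover have "{g \<in> edges R. ends R g = {u}} = {g \<in> edges G. ends G g = {u}}"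
      unfolding eR ends using uG by auto
    moreover have "degree G u = 4" using assms(3) uG by (simp add: regular_def)
    ultimately show ?thesis by (auto simp: degree_def)
  qed
  note deg = this
  define S where "S = ?S"
  note S = S[folded S_def]
  from even_card_tree_2_forests_one_five_split[OF R S] deg
  have even: "even (card {(\<psi>, \<phi>) \<in> tree_2_forests R. \<exists>T\<in>components (spanning_subgraph R \<phi>). card (T \<inter> S) = 1})"
    (is "even (card ?U)")
    unfolding S_def by blast
  let ?P = "\<lambda>x. tree_forest_pairs R {x} (S - {x})"
  have P: "?P x = {(\<psi>, \<phi>) \<in> tree_2_forests R. \<exists>T\<in>components (spanning_subgraph R \<phi>). T \<inter> S = {x}}"
    if "x \<in> S" for x
    using tree_forest_pairs_singleton[OF S(1) that] .
  have U: "(\<Union>x\<in>S. ?P x) = ?U"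
  proof (intro equalityI subsetI)
    fix p assume "p \<in> (\<Union>x\<in>S. ?P x)"
    then obtain x where x: "x \<in> S" "p \<in> ?P x" by blast
    obtain \<psi> \<phi> where p: "p = (\<psi>, \<phi>)" by (cases p)
    obtain T where "p \<in> tree_2_forests R" "T \<in> components (spanning_subgraph R \<phi>)" "T \<inter> S = {x}"
      using x(2) unfolding P[OF x(1)] p by blast
    moreover from this have "card (T \<inter> S) = 1" by simp
    ultimately show "p \<in> ?U" using p by blast
  next
    fix p assume pU: "p \<in> ?U"
    obtain \<psi> \<phi> where p: "p = (\<psi>, \<phi>)" by (cases p)
    obtain T where T: "p \<in> tree_2_forests R" "T \<in> components (spanning_subgraph R \<phi>)" "card (T \<inter> S) = 1"
      using pU unfolding p by blast
    then obtain x where x: "T \<inter> S = {x}" using card_1_singletonE by blast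
    then have xS: "x \<in> S" by blast
    have "p \<in> ?P x" unfolding P[OF xS] using T x p by blast
    then show "p \<in> (\<Union>x\<in>S. ?P x)" using xS by blast
  qed
  have finU: "finite ?U"
    by (rule finite_subset[OF _ finite_tree_2_forests[OF R]]) blast
  \<comment> \<open>The two parts would be complementary and cover the six elements of
    \<open>S\<close> with only two.\<close>
  have disjoint: "?P x \<inter> ?P y = {}" if xy: "x \<in> S" "y \<in> S" "x \<noteq> y" for x y
  proof (rule ccontr)
    assume "?P x \<inter> ?P y \<noteq> {}"
    then obtain \<psi> \<phi> T T' where p: "(\<psi>, \<phi>) \<in> tree_2_forests R"
      and T: "T \<in> components (spanning_subgraph R \<phi>)" "T \<inter> S = {x}"
      and T': "T' \<in> components (spanning_subgraph R \<phi>)" "T' \<inter> S = {y}"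
      unfolding P[OF xy(1)] P[OF xy(2)] by blast
    have "components (spanning_subgraph R \<phi>) = {T, verts R - T}"
      using two_components[OF _ T(1)] p by (simp add: tree_2_forests_def spanning_2_forest_def)
    moreover have "T' \<noteq> T" using T T' xy(3) by auto
    ultimately have "T' = verts R - T" using T'(1) by blast
    then have "S = (T \<inter> S) \<union> (T' \<inter> S)" using S(1) by blast
    then have "card S \<le> card (T \<inter> S) + card (T' \<inter> S)" by (metis card_Un_le)
    then show False using S(2) T(2) T'(2) by simp
  qed
  have "card (\<Union>x\<in>S. ?P x) = (\<Sum>x\<in>S. card (?P x))"
  proof (rule card_UN_disjoint)
    show "\<forall>x\<in>S. finite (?P x)"
      using finite_subset[OF UN_upper finU[folded U]] by blast
    show "\<forall>x\<in>S. \<forall>y\<in>S. x \<noteq> y \<longrightarrow> ?P x \<inter> ?P y = {}" using disjoint by blast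
  qed (simp add: S_def)
  then have sum: "even (\<Sum>x\<in>S. card (?P x))" using even unfolding U by simp
  have rest: "S - {a} = {b, c, d, e, f}" "S - {b} = {a, c, d, e, f}" "S - {c} = {a, b, d, e, f}"
    "S - {d} = {a, b, c, e, f}" "S - {e} = {a, b, c, d, f}" "S - {f} = {a, b, c, d, e}"
    using dist unfolding S_def by auto
  have "\<exists>\<iota>. fixed_point_free_involution_on (\<Union>x\<in>S. ?P x) \<iota>"
    unfolding U fixed_point_free_involution_on_iff_even_card[OF finU] by (rule even)
  also have "(\<Union>x\<in>S. ?P x) = ?P a \<union> ?P b \<union> ?P c \<union> ?P d \<union> ?P e \<union> ?P f"
    unfolding S_def by (simp only: UN_insert UN_empty Un_empty_right Un_assoc)
  finally have inv: "\<exists>\<iota>. fixed_point_free_involution_on (?P a \<union> ?P b \<union> ?P c \<union> ?P d \<union> ?P e \<union> ?P f) \<iota>" .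
  have sum_S: "sum g S = g a + g b + g c + g d + g e + g f" for g :: "'v \<Rightarrow> nat"
    using dist unfolding S_def by simp
  have "(\<Sum>x\<in>S. card (?P x)) = card (?P a) + card (?P b) + card (?P c) + card (?P d) + card (?P e) + card (?P f)"
    using sum_S .
  then have "[card (?P a) + card (?P b) + card (?P c) + card (?P d) + card (?P e) + card (?P f) = 0] (mod 2)"
    using sum by (simp only: cong_0_iff)
  with inv show ?thesis unfolding rest by (rule conjI)
qed

end
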